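(* Let $n\ge 2$ and $s\in(0,1)$. Let $u$ be a radial $C^2$ function on $\mathbb{R}^n$, $u(x)=u(|x|)$, such that $$\int_0^{+\infty}\frac{|u(r)|}{(1+r)^{n+2s}}\,r^{n-1}\,dr<+\infty .$$ Then for every $x\in\mathbb{R}^n$ with $r=|x|>0$, $$(-\Delta)^s u(r)=c_{s,n}\,r^{-2s}\int_1^{+\infty}\Big(u(r)-u(r\tau)+\big(u(r)-u(\tfrac{r}{\tau})\big)\tau^{-n+2s}\Big)\,\tau\,(\tau^2-1)^{-1-2s}\,H(\tau)\,d\tau,$$ where $$H(\tau)=2\pi\alpha_n\int_0^{\pi}\sin^{n-2}\theta\,\frac{\big(\sqrt{\tau^2-\sin^2\theta}+\cos\theta\big)^{1+2s}}{\sqrt{\tau^2-\sin^2\theta}}\,d\theta,\quad \tau\ge1,\qquad \alpha_n=\frac{\pi^{\frac{n-3}{2}}}{\Gamma(\frac{n-1}{2})}.$$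
   Context: For $s\in(0,1)$ and a locally integrable $u:\mathbb{R}^n\to\mathbb{R}$ with $\int_{\mathbb{R}^n}\frac{|u(x)|}{(1+|x|^2)^{(n+2s)/2}}dx<\infty$, the fractional Laplacian is $(-\Delta)^s u(x)=c_{s,n}\int_{\mathbb{R}^n}\frac{u(x)-u(y)}{|x-y|^{n+2s}}dy$ (principal value when $s\ge 1/2$), where $c_{s,n}>0$ is a normalization constant; for general such $u$ it is understood in the sense of distributions, $\langle(-\Delta)^s u,h\rangle=\int u\,(-\Delta)^s h\,dx$ for $h\in C_0^\infty(\mathbb{R}^n)$. For a radial function we write $u(r)$, $r=|x|$. *)

theory Defs
  imports "HOL-Analysis.Analysis"
begin

definition C2_on_UNIV :: "('a::euclidean_space \<Rightarrow> real) \<Rightarrow> bool" where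
  "C2_on_UNIV f \<longleftrightarrow> (\<exists>f' :: 'a \<Rightarrow> ('a \<Rightarrow>\<^sub>L real). \<exists>f'' :: 'a \<Rightarrow> ('a \<Rightarrow>\<^sub>L ('a \<Rightarrow>\<^sub>L real)).
     (\<forall>x. (f has_derivative blinfun_apply (f' x)) (at x)) \<and>
     (\<forall>x. (f' has_derivative blinfun_apply (f'' x)) (at x)) \<and>
     continuous_on UNIV f'')"

definition frac_const :: "real \<Rightarrow> nat \<Rightarrow> real" where
  "frac_const s n = s * 4 powr s * Gamma (real n / 2 + s) / (pi powr (real n / 2) * Gamma (1 - s))"

definition frac_trunc :: "real \<Rightarrow> (real^'n \<Rightarrow> real) \<Rightarrow> real^'n \<Rightarrow> real \<Rightarrow> real" where
  "frac_trunc s u x e = integral {y. e < dist x y}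
      (\<lambda>y. (u x - u y) / dist x y powr (real CARD('n) + 2 * s))"

definition has_frac_laplacian :: "real \<Rightarrow> (real^'n \<Rightarrow> real) \<Rightarrow> real^'n \<Rightarrow> real \<Rightarrow> bool" where
  "has_frac_laplacian s u x L \<longleftrightarrow>
     ((\<lambda>e. frac_const s CARD('n) * frac_trunc s u x e) \<longlongrightarrow> L) (at_right 0)"

definition alpha_n :: "nat \<Rightarrow> real" where
  "alpha_n n = pi powr ((real n - 3) / 2) / Gamma ((real n - 1) / 2)"

definition H_fun :: "real \<Rightarrow> nat \<Rightarrow> real \<Rightarrow> real" where
  "H_fun s n \<tau> = 2 * pi * alpha_n n * integral {0..pi} (\<lambda>\<theta>.
      sin \<theta> ^ (n - 2) * (sqrt (\<tau>\<^sup>2 - (sin \<theta>)\<^sup>2) + cos \<theta>) powr (1 + 2 * s)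
        / sqrt (\<tau>\<^sup>2 - (sin \<theta>)\<^sup>2))"

end

theory Submission
  imports Defs "HOL-Probability.Sinc_Integral"
begin

text \<open>
  In polar coordinates around the origin, with \<open>|x| = r\<close> and \<open>|y| = r \<tau>\<close>, integrating out the
  angle turns the truncated integral over \<open>|x - y| > r \<delta>\<close> into a multiple of
  \<open>\<integral> (u r - u (r \<tau>)) \<tau>^(n-1) G\<^sub>\<delta> \<tau> d\<tau>\<close> over \<open>\<tau> > 0\<close>, where \<open>G\<^sub>\<delta>\<close> integrates the (scaled)
  kernel \<open>q^(-n-2s)\<close> over the directions with \<open>q > \<delta>\<close>. Since \<open>q (1/\<tau>) = q \<tau> / \<tau>\<close>, the inversion
  \<open>\<tau> \<mapsto> 1/\<tau>\<close> folds the part \<open>\<tau> < 1\<close> onto \<open>\<tau> > 1\<close>, but with \<open>G\<^sub>\<delta>\<^sub>\<tau>\<close> in place of \<open>G\<^sub>\<delta>\<close>. With \<open>G\<^sub>\<delta>\<close> in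
  both places the integrand has a double zero at \<open>\<tau> = 1\<close> and dominated convergence applies; the
  error of the replacement is supported in \<open>1 < \<tau> \<le> 1 + 2\<delta>\<close> and bounded by \<open>\<delta>^(1-n-2s)\<close> times the
  volume of a shell of radius \<open>\<delta>\<close> and thickness \<open>2\<delta>\<^sup>2\<close>, hence is of order \<open>\<delta>^(2-2s)\<close>. Finally \<open>G\<^sub>0\<close>
  becomes \<open>H\<close> when the sphere \<open>|y| = \<tau>\<close> is parametrised by the angle at a unit vector
  instead of the angle at the origin.
\<close>

section \<open>Polar coordinates with respect to an axis\<close>

text \<open>Near \<open>\<tau> = 1\<close> the increment of \<open>u\<close> vanishes in general
  only to first order, while the angular kernel has size
  \<open>(\<tau> - 1) powr (- 1 - 2 * s)\<close>. For s >= 1/2 the two sides of 1 can therefore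
  diverge separately. Only the folded integrand, with its second-order zero, is integrable, and this
  uses s < 1. The replacement error cannot be controlled by the available pointwise bound of the
  truncated kernel: \<delta>^(-n-2s), times an increment of order \<delta>, times a window of length
  2 \<delta>, gives \<delta>^(2-n-2s), which does not tend to 0. The error is kept integrated
  instead and read back as a volume in R^n, by the same polar formula applied to a constant radial
  function. The polar formula is proved for nonnegative integrals and then stated as an equality of
  measures. Fubini and the substitutions then need no integrability, and signed integrands enter
  only after the radial measure is known.\<close>

lemma nn_integral_lborel_shift:
  fixes a :: "'a::euclidean_space"
  assumes [measurable]: "f \<in> borel_measurable borel" and c: "\<bar>c\<bar> = (1::real)"
  shows "(\<integral>\<^sup>+y. f (a + c *\<^sub>R y) \<partial>lborel) = (\<integral>\<^sup>+y. f y \<partial>lborel)"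
proof -
  have "distr lborel borel (\<lambda>y. a + c *\<^sub>R y) = (lborel :: 'a measure)"
    using lborel_affine[of c a] c by (auto simp: density_1)
  then have "(\<integral>\<^sup>+y. f y \<partial>lborel) = (\<integral>\<^sup>+y. f y \<partial>distr lborel borel (\<lambda>y. a + c *\<^sub>R y))"
    by simp
  also have "\<dots> = (\<integral>\<^sup>+y. f (a + c *\<^sub>R y) \<partial>lborel)"
    by (subst nn_integral_distr) auto
  finally show ?thesis by simp
qed

text \<open>Uniqueness of Haar measure: a double integral evaluated in both orders compares the
  measures of two arbitrary sets, and the unit ball is preserved.\<close>
lemma distr_lborel_isometry:
  fixes T :: "'a::euclidean_space \<Rightarrow> 'a"
  assumes T: "orthogonal_transformation T"
  shows "distr lborel borel T = (lborel :: 'a measure)"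
proof (rule measure_eqI)
  let ?M = "distr lborel borel T :: 'a measure"
  have linT: "linear T" by (simp add: T orthogonal_transformation_linear)
  have Tm[measurable]: "T \<in> borel_measurable borel"
    using linT by (intro borel_measurable_continuous_onI linear_continuous_on linear_conv_bounded_linear[THEN iffD1])
  have surj: "surj T" by (simp add: T orthogonal_transformation_surj)
  have nT: "norm (T x) = norm x" for x by (simp add: T orthogonal_transformation_norm)
  show "sets ?M = sets (lborel :: 'a measure)" by simp
  fix A assume "A \<in> sets ?M"
  then have A[measurable]: "A \<in> sets borel" by simp
  define B where "B = cball (0::'a) 1"
  have B[measurable]: "B \<in> sets borel" by (simp add: B_def)
  have "(\<integral>\<^sup>+x. \<integral>\<^sup>+y. indicator A (T x) * indicator B (T x + y) \<partial>lborel \<partial>lborel)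
      = (\<integral>\<^sup>+x. indicator A (T x) * emeasure lborel B \<partial>lborel)"
  proof (rule nn_integral_cong)
    fix x
    have "(\<integral>\<^sup>+y. indicator A (T x) * indicator B (T x + y) \<partial>lborel)
        = indicator A (T x) * (\<integral>\<^sup>+y. indicator B (T x + 1 *\<^sub>R y) \<partial>lborel)"
      by (subst nn_integral_cmult) (auto simp: B)
    also have "(\<integral>\<^sup>+y. indicator B (T x + 1 *\<^sub>R y) \<partial>lborel) = emeasure lborel B"
      by (subst nn_integral_lborel_shift) auto
    finally show "(\<integral>\<^sup>+y. indicator A (T x) * indicator B (T x + y) \<partial>lborel)
      = indicator A (T x) * emeasure lborel B" .
  qed
  also have "\<dots> = emeasure ?M A * emeasure lborel B"
    by (subst nn_integral_multc, simp, subst nn_integral_distr[of T lborel borel "indicator A", symmetric])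
       auto
  finally have 1: "(\<integral>\<^sup>+x. \<integral>\<^sup>+y. indicator A (T x) * indicator B (T x + y) \<partial>lborel \<partial>lborel)
      = emeasure ?M A * emeasure lborel B" .
  have "(\<integral>\<^sup>+x. \<integral>\<^sup>+y. indicator A (T x) * indicator B (T x + y) \<partial>lborel \<partial>lborel)
      = (\<integral>\<^sup>+y. \<integral>\<^sup>+x. indicator A (T x) * indicator B (T x + y) \<partial>lborel \<partial>lborel)"
    by (rule lborel_pair.Fubini') measurable
  \<comment> \<open>For fixed \<open>y = T z\<close>, the translation
    \<open>x \<mapsto> z + x\<close> moves the shift by \<open>y\<close> from \<open>B\<close> to
    \<open>A\<close>, so that the next integration in \<open>y\<close> sees only the measure of
    \<open>A\<close>.\<close>
  also have "\<dots> = (\<integral>\<^sup>+y. \<integral>\<^sup>+x. indicator A (T x - y) * indicator B (T x) \<partial>lborel \<partial>lborel)"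
  proof (rule nn_integral_cong)
    fix y
    obtain z where z: "y = T z" using surj by blast
    have "(\<integral>\<^sup>+x. indicator A (T x - y) * indicator B (T x) \<partial>lborel)
      = (\<integral>\<^sup>+x. indicator A (T (z + 1 *\<^sub>R x) - y) * indicator B (T (z + 1 *\<^sub>R x)) \<partial>lborel)"
      by (rule nn_integral_lborel_shift[symmetric]) auto
    then show "(\<integral>\<^sup>+x. indicator A (T x) * indicator B (T x + y) \<partial>lborel)
      = (\<integral>\<^sup>+x. indicator A (T x - y) * indicator B (T x) \<partial>lborel)"
      by (simp add: z linear_add[OF linT] add.commute)
  qed
  also have "\<dots> = (\<integral>\<^sup>+x. \<integral>\<^sup>+y. indicator A (T x - y) * indicator B (T x) \<partial>lborel \<partial>lborel)"
    by (rule lborel_pair.Fubini') measurable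
  also have "\<dots> = (\<integral>\<^sup>+x. emeasure lborel A * indicator B (T x) \<partial>lborel)"
  proof (rule nn_integral_cong)
    fix x
    have "(\<integral>\<^sup>+y. indicator A (T x - y) * indicator B (T x) \<partial>lborel)
        = (\<integral>\<^sup>+y. indicator A (T x + (-1) *\<^sub>R y) \<partial>lborel) * indicator B (T x)"
      by (subst nn_integral_multc) auto
    also have "(\<integral>\<^sup>+y. indicator A (T x + (-1) *\<^sub>R y) \<partial>lborel) = emeasure lborel A"
      by (subst nn_integral_lborel_shift) auto
    finally show "(\<integral>\<^sup>+y. indicator A (T x - y) * indicator B (T x) \<partial>lborel)
      = emeasure lborel A * indicator B (T x)" .
  qed
  \<comment> \<open>The unit ball is invariant under an isometry, which removes \<open>T\<close>
    from the right-hand side; a positive finite factor then cancels.\<close>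
  also have "\<dots> = (\<integral>\<^sup>+x. emeasure lborel A * indicator B x \<partial>lborel)"
    by (rule nn_integral_cong) (simp add: B_def indicator_def nT)
  also have "\<dots> = emeasure lborel A * emeasure lborel B"
    by (subst nn_integral_cmult) auto
  finally have "emeasure ?M A * emeasure lborel B = emeasure lborel A * emeasure lborel B"
    using 1 by simp
  moreover have "emeasure lborel B \<noteq> 0" "emeasure lborel B \<noteq> \<infinity>"
    using unit_ball_vol_pos[OF of_nat_0_le_iff, THEN less_imp_neq, of "DIM('a)"] emeasure_cball[of 1 "0::'a"] by (auto simp: B_def)
  ultimately show "emeasure ?M A = emeasure lborel A"
    by (metis ennreal_mult_divide_eq infinity_ennreal_def)
qed

text \<open>The norm has distribution function \<open>unit_ball_vol m * a ^ m\<close> on half-lines,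
  which generate the Borel sets; the density is its derivative. A product measure over a finite
  index set is used because the coordinates orthogonal to an axis do not form a type of their
  own.\<close>

lemma nn_integral_PiM_norm:
  fixes f :: "real \<Rightarrow> ennreal"
  assumes A: "finite A" "A \<noteq> {}" and f[measurable]: "f \<in> borel_measurable borel"
  shows "(\<integral>\<^sup>+x. f (sqrt (\<Sum>i\<in>A. (x i)\<^sup>2)) \<partial>(\<Pi>\<^sub>M i\<in>A. lborel))
     = (\<integral>\<^sup>+\<rho>. ennreal (card A * unit_ball_vol (card A) * \<rho> ^ (card A - 1)) * indicator {0<..} \<rho> * f \<rho> \<partial>lborel)"
proof -
  let ?m = "card A" and ?P = "\<Pi>\<^sub>M i\<in>A. lborel :: real measure"
  let ?d = "\<lambda>\<rho>. ennreal (?m * unit_ball_vol ?m * \<rho> ^ (?m - 1)) * indicator {0<..} \<rho>"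
  have m: "?m > 0" using A by (simp add: card_gt_0_iff)
  let ?N = "distr ?P borel (\<lambda>x. sqrt (\<Sum>i\<in>A. (x i)\<^sup>2))"
  have val: "emeasure ?N {..a} = ennreal (if a \<ge> 0 then unit_ball_vol ?m * a ^ ?m else 0)" for a
  proof -
    have E: "emeasure ?N {..a} = emeasure ?P ({x. sqrt (\<Sum>i\<in>A. (x i)\<^sup>2) \<le> a} \<inter> space ?P)"
      by (subst emeasure_distr) (auto intro!: arg_cong2[where f=emeasure])
    consider "a < 0" | "a = 0" | "a > 0" by linarith
    then show ?thesis
    proof cases
      case 1
      then have "{x. sqrt (\<Sum>i\<in>A. (x i)\<^sup>2) \<le> a} = {}"
        by (auto simp: not_le intro!: less_le_trans[OF 1] sum_nonneg)
      with 1 E show ?thesis by simp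
    next
      case 2
      \<comment> \<open>The ball volume is known for positive radii only, so radius 0 is squeezed by
        letting \<open>b\<close> tend to 0.\<close>
      have "emeasure ?N {..0} \<le> ennreal (unit_ball_vol ?m * b ^ ?m)" if "b > 0" for b
      proof -
        have "emeasure ?N {..0} \<le> emeasure ?N {..b}" using that by (intro emeasure_mono) auto
        also have "\<dots> = emeasure ?P ({x. sqrt (\<Sum>i\<in>A. (x i)\<^sup>2) \<le> b} \<inter> space ?P)"
          by (subst emeasure_distr) (auto intro!: arg_cong2[where f=emeasure])
        finally show ?thesis by (simp add: emeasure_cball_aux[OF A(1) that])
      qed
      then have "\<forall>\<^sub>F b in at_right 0. emeasure ?N {..0} \<le> ennreal (unit_ball_vol ?m * b ^ ?m)"
        by (auto simp: eventually_at_filter)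
      moreover have "((\<lambda>b. ennreal (unit_ball_vol ?m * b ^ ?m)) \<longlongrightarrow> ennreal (unit_ball_vol ?m * 0 ^ ?m)) (at_right 0)"
        by (intro tendsto_intros)
      ultimately have "emeasure ?N {..0} \<le> ennreal (unit_ball_vol ?m * 0 ^ ?m)"
        by (intro tendsto_lowerbound) auto
      moreover have "0 ^ ?m = (0::real)" using m by simp
      ultimately show ?thesis by (simp add: 2)
    next
      case 3
      then show ?thesis using emeasure_cball_aux[OF A(1) 3] E by simp
    qed
  qed
  have "?N = density lborel ?d"
  proof (rule measure_eqI_generator_eq[where E = "range atMost" and A = "\<lambda>i. {..real i}" and \<Omega>=UNIV])
    show "Int_stable (range (atMost :: real \<Rightarrow> _))" by (auto simp: Int_stable_def)
    show "sets ?N = sigma_sets UNIV (range atMost)" "sets (density lborel ?d) = sigma_sets UNIV (range atMost)"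
      by (simp_all add: borel_eq_atMost)
    show "(\<Union>i. {..real i}) = UNIV" using real_arch_simple by auto
    show "emeasure ?N {..real i} \<noteq> \<infinity>" for i by (subst val) simp
    fix X assume "X \<in> range (atMost :: real \<Rightarrow> _)"
    then obtain a where X: "X = {..a}" by auto
    have "emeasure (density lborel ?d) X = (\<integral>\<^sup>+\<rho>. ?d \<rho> * indicator {..a} \<rho> \<partial>lborel)"
      unfolding X by (subst emeasure_density) auto
    also have "\<dots> = (\<integral>\<^sup>+\<rho>. ennreal (?m * unit_ball_vol ?m * \<rho> ^ (?m - 1)) * indicator {0..a} \<rho> \<partial>lborel)"
      by (intro nn_integral_cong_AE AE_I[of _ _ "{0}"]) (auto simp: indicator_def)
    also have "\<dots> = ennreal (if a \<ge> 0 then unit_ball_vol ?m * a ^ ?m else 0)"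
    proof (cases "a \<ge> 0")
      case True
      have "(\<integral>\<^sup>+\<rho>. ennreal (?m * unit_ball_vol ?m * \<rho> ^ (?m - 1)) * indicator {0..a} \<rho> \<partial>lborel)
        = ennreal (unit_ball_vol ?m * a ^ ?m - unit_ball_vol ?m * 0 ^ ?m)"
        using True by (intro nn_integral_FTC_Icc)
          (auto intro!: derivative_eq_intros mult_nonneg_nonneg)
      then show ?thesis using True m by simp
    qed simp
    finally show "emeasure ?N X = emeasure (density lborel ?d) X" by (simp add: X val)
  qed auto
  then have "(\<integral>\<^sup>+\<rho>. f \<rho> \<partial>?N) = (\<integral>\<^sup>+\<rho>. f \<rho> \<partial>density lborel ?d)" by simp
  then show ?thesis
    by (subst (asm) nn_integral_distr) (auto simp: nn_integral_density)
qed

text \<open>Split off the coordinate \<open>t\<close> along \<open>e\<close>: the other coordinates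
  enter only through their norm \<open>\<rho>\<close>, since the squared norm of \<open>y\<close> is
  the sum of the squares of \<open>t\<close> and \<open>\<rho>\<close>. Dimension at least 2 keeps
  the set of other coordinates nonempty.\<close>

lemma nn_integral_cylinder:
  fixes F :: "real \<Rightarrow> real \<Rightarrow> ennreal"
  assumes e: "e \<in> (Basis :: 'a::euclidean_space set)" and dim: "DIM('a) \<ge> 2"
    and F[measurable]: "case_prod F \<in> borel_measurable (borel \<Otimes>\<^sub>M borel)"
  shows "(\<integral>\<^sup>+y. F (norm y) (y \<bullet> e) \<partial>lborel)
     = (\<integral>\<^sup>+t. \<integral>\<^sup>+\<rho>. ennreal ((DIM('a) - 1) * unit_ball_vol (DIM('a) - 1) * \<rho> ^ (DIM('a) - 2)) * indicator {0<..} \<rho>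
          * F (sqrt (t\<^sup>2 + \<rho>\<^sup>2)) t \<partial>lborel \<partial>lborel)"
proof -
  define A where "A = (Basis :: 'a set) - {e}"
  have A: "finite A" "e \<notin> A" "Basis = insert e A" "card A = DIM('a) - 1"
    using e by (auto simp: A_def)
  have "A \<noteq> {}"
  proof
    assume "A = {}"
    with A(4) dim show False by simp
  qed
  interpret product_sigma_finite "\<lambda>_. lborel :: real measure" by standard
  have nrm: "norm (\<Sum>b\<in>Basis. f b *\<^sub>R b) = sqrt (\<Sum>b\<in>Basis. (f b)\<^sup>2)" for f :: "'a \<Rightarrow> real"
    by (subst euclidean_dist_l2[of 0, simplified dist_0_norm])
       (simp add: L2_set_def)
  have "(\<integral>\<^sup>+y. F (norm y) (y \<bullet> e) \<partial>(lborel :: 'a measure))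
      = (\<integral>\<^sup>+f. F (sqrt (\<Sum>b\<in>Basis. (f b)\<^sup>2)) (f e) \<partial>(\<Pi>\<^sub>M b\<in>Basis. lborel))"
    by (subst lborel_eq, subst nn_integral_distr) (use e in \<open>auto simp: nrm\<close>)
  also have "\<dots> = (\<integral>\<^sup>+t. \<integral>\<^sup>+x. F (sqrt (t\<^sup>2 + (sqrt (\<Sum>b\<in>A. (x b)\<^sup>2))\<^sup>2)) t \<partial>(\<Pi>\<^sub>M b\<in>A. lborel) \<partial>lborel)"
  proof -
    have s: "(\<Sum>b\<in>A. (if b = e then t else x b)\<^sup>2) = (\<Sum>b\<in>A. (x b)\<^sup>2)" for t and x :: "'a \<Rightarrow> real"
      using A(2) by (intro sum.cong) auto
    show ?thesis
      unfolding A(3) using A(1,2)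
      by (subst product_nn_integral_insert_rev) (auto simp: s sum_nonneg)
  qed
  also have "\<dots> = (\<integral>\<^sup>+t. \<integral>\<^sup>+\<rho>. ennreal (card A * unit_ball_vol (card A) * \<rho> ^ (card A - 1)) * indicator {0<..} \<rho>
          * F (sqrt (t\<^sup>2 + \<rho>\<^sup>2)) t \<partial>lborel \<partial>lborel)"
    using A(1) \<open>A \<noteq> {}\<close> by (subst nn_integral_PiM_norm) auto
  finally show ?thesis
    using dim by (simp add: A(4) of_nat_diff numeral_2_eq_2)
qed

text \<open>The angular variable is \<open>k = cot \<phi>\<close>, \<open>\<phi>\<close> being the angle between \<open>y\<close> and \<open>e\<close>:
  then only linear substitutions on the whole line are needed.\<close>
lemma nn_integral_polar_basis:
  fixes F :: "real \<Rightarrow> real \<Rightarrow> ennreal"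
  assumes e: "e \<in> (Basis :: 'a::euclidean_space set)" and dim: "DIM('a) \<ge> 2" and r: "r > 0"
    and F[measurable]: "case_prod F \<in> borel_measurable (borel \<Otimes>\<^sub>M borel)"
  shows "(\<integral>\<^sup>+y. F (norm y) (y \<bullet> e) \<partial>lborel)
     = (\<integral>\<^sup>+\<tau>. \<integral>\<^sup>+k. ennreal (r ^ DIM('a) * ((DIM('a) - 1) * unit_ball_vol (DIM('a) - 1)) * \<tau> ^ (DIM('a) - 1)
            / sqrt (1 + k\<^sup>2) ^ DIM('a)) * indicator {0<..} \<tau>
          * F (r * \<tau>) (r * \<tau> * k / sqrt (1 + k\<^sup>2)) \<partial>lborel \<partial>lborel)"
proof -
  let ?n = "DIM('a)"
  define c where "c = (?n - 1) * unit_ball_vol (?n - 1)"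
  have c: "c \<ge> 0" using dim by (simp add: c_def)
  obtain m where m: "?n = Suc (Suc m)" using dim by (metis add_2_eq_Suc le_Suc_ex)
  have pos: "sqrt (1 + k\<^sup>2) > 0" "1 + k\<^sup>2 > 0" for k :: real
    by (simp_all add: add_pos_nonneg)
  have "(\<integral>\<^sup>+y. F (norm y) (y \<bullet> e) \<partial>lborel)
     = (\<integral>\<^sup>+t. \<integral>\<^sup>+\<rho>. ennreal (c * \<rho> ^ m) * indicator {0<..} \<rho> * F (sqrt (t\<^sup>2 + \<rho>\<^sup>2)) t \<partial>lborel \<partial>lborel)"
    using nn_integral_cylinder[OF e dim F] by (simp add: c_def m)
  also have "\<dots> = (\<integral>\<^sup>+\<rho>. \<integral>\<^sup>+t. ennreal (c * \<rho> ^ m) * indicator {0<..} \<rho> * F (sqrt (t\<^sup>2 + \<rho>\<^sup>2)) t \<partial>lborel \<partial>lborel)"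
    by (rule lborel_pair.Fubini') measurable
  \<comment> \<open>For fixed \<open>\<rho>\<close> put \<open>t = \<rho> * k\<close>; the Jacobian
    \<open>\<rho>\<close> raises the exponent from \<open>m\<close> to \<open>Suc m\<close>.\<close>
  also have "\<dots> = (\<integral>\<^sup>+\<rho>. \<integral>\<^sup>+k. ennreal (c * \<rho> ^ Suc m) * indicator {0<..} \<rho> * F (\<rho> * sqrt (1 + k\<^sup>2)) (\<rho> * k) \<partial>lborel \<partial>lborel)"
  proof (rule nn_integral_cong)
    fix \<rho> :: real
    show "(\<integral>\<^sup>+t. ennreal (c * \<rho> ^ m) * indicator {0<..} \<rho> * F (sqrt (t\<^sup>2 + \<rho>\<^sup>2)) t \<partial>lborel)
      = (\<integral>\<^sup>+k. ennreal (c * \<rho> ^ Suc m) * indicator {0<..} \<rho> * F (\<rho> * sqrt (1 + k\<^sup>2)) (\<rho> * k) \<partial>lborel)"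
    proof (cases "\<rho> > 0")
      case True
      have "sqrt ((\<rho> * k)\<^sup>2 + \<rho>\<^sup>2) = \<rho> * sqrt (1 + k\<^sup>2)" for k
      proof -
        have "(\<rho> * k)\<^sup>2 + \<rho>\<^sup>2 = \<rho>\<^sup>2 * (1 + k\<^sup>2)" by (simp add: algebra_simps power_mult_distrib)
        then show ?thesis using True by (simp add: real_sqrt_mult)
      qed
      moreover have "ennreal \<rho> * (ennreal (c * \<rho> ^ m) * X) = ennreal (c * \<rho> ^ Suc m) * X" for X
      proof -
        have "\<rho> * (c * \<rho> ^ m) = c * \<rho> ^ Suc m" by simp
        then have "ennreal \<rho> * ennreal (c * \<rho> ^ m) = ennreal (c * \<rho> ^ Suc m)"
          using True by (metis ennreal_mult' less_imp_le)
        then show ?thesis by (metis mult.assoc)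
      qed
      ultimately show ?thesis using True
        by (subst nn_integral_real_affine[where c=\<rho> and t=0])
           (auto simp: nn_integral_cmult[symmetric])
    qed simp
  qed
  also have "\<dots> = (\<integral>\<^sup>+k. \<integral>\<^sup>+\<rho>. ennreal (c * \<rho> ^ Suc m) * indicator {0<..} \<rho> * F (\<rho> * sqrt (1 + k\<^sup>2)) (\<rho> * k) \<partial>lborel \<partial>lborel)"
    by (rule lborel_pair.Fubini') measurable
  also have "\<dots> = (\<integral>\<^sup>+k. \<integral>\<^sup>+\<tau>. ennreal (r ^ ?n * c * \<tau> ^ Suc m / sqrt (1 + k\<^sup>2) ^ ?n) * indicator {0<..} \<tau>
        * F (r * \<tau>) (r * \<tau> * k / sqrt (1 + k\<^sup>2)) \<partial>lborel \<partial>lborel)"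
  proof (rule nn_integral_cong)
    fix k :: real
    \<comment> \<open>For fixed \<open>k\<close> the substitution
      \<open>\<rho> = r * \<tau> / w\<close> turns the norm \<open>\<rho> * w\<close> into
      \<open>r * \<tau>\<close>; the Jacobian and the density together contribute \<open>w\<close>
      to the power -n.\<close>
    define w where "w = sqrt (1 + k\<^sup>2)"
    have w: "w > 0" using pos by (simp add: w_def)
    have i: "indicator {0<..} (r * \<tau> / w) = (indicator {0<..} \<tau> :: ennreal)" for \<tau>
      using w r by (simp add: indicator_def zero_less_mult_iff zero_less_divide_iff)
    have d: "ennreal (r / w) * (ennreal (c * (r * \<tau> / w) ^ Suc m) * indicator {0<..} \<tau> * X)
        = ennreal (r ^ ?n * c * \<tau> ^ Suc m / w ^ ?n) * indicator {0<..} \<tau> * X" for \<tau> X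
    proof (cases "\<tau> > 0")
      case True
      have "r / w * (c * (r * \<tau> / w) ^ Suc m) = r ^ ?n * c * \<tau> ^ Suc m / w ^ ?n"
        by (simp add: m power_divide power_mult_distrib)
      then have "ennreal (r / w) * ennreal (c * (r * \<tau> / w) ^ Suc m) = ennreal (r ^ ?n * c * \<tau> ^ Suc m / w ^ ?n)"
        using r w by (metis ennreal_mult' divide_nonneg_pos less_imp_le)
      then show ?thesis by (metis mult.assoc)
    qed simp
    have "(\<integral>\<^sup>+\<rho>. ennreal (c * \<rho> ^ Suc m) * indicator {0<..} \<rho> * F (\<rho> * w) (\<rho> * k) \<partial>lborel)
      = ennreal (r / w) * (\<integral>\<^sup>+\<tau>. ennreal (c * (r * \<tau> / w) ^ Suc m) * indicator {0<..} \<tau>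
        * F (r * \<tau>) (r * \<tau> * k / w) \<partial>lborel)"
      using r w by (subst nn_integral_real_affine[where c="r / w" and t=0]) (simp_all add: i del: power_Suc)
    also have "\<dots> = (\<integral>\<^sup>+\<tau>. ennreal (r / w) * (ennreal (c * (r * \<tau> / w) ^ Suc m) * indicator {0<..} \<tau>
        * F (r * \<tau>) (r * \<tau> * k / w)) \<partial>lborel)"
      by (rule nn_integral_cmult[symmetric]) measurable
    finally show "(\<integral>\<^sup>+\<rho>. ennreal (c * \<rho> ^ Suc m) * indicator {0<..} \<rho> * F (\<rho> * w) (\<rho> * k) \<partial>lborel)
      = (\<integral>\<^sup>+\<tau>. ennreal (r ^ ?n * c * \<tau> ^ Suc m / w ^ ?n) * indicator {0<..} \<tau>
        * F (r * \<tau>) (r * \<tau> * k / w) \<partial>lborel)"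
      by (simp only: d)
  qed
  also have "\<dots> = (\<integral>\<^sup>+\<tau>. \<integral>\<^sup>+k. ennreal (r ^ ?n * c * \<tau> ^ Suc m / sqrt (1 + k\<^sup>2) ^ ?n) * indicator {0<..} \<tau>
        * F (r * \<tau>) (r * \<tau> * k / sqrt (1 + k\<^sup>2)) \<partial>lborel \<partial>lborel)"
    by (rule lborel_pair.Fubini') measurable
  finally show ?thesis by (simp add: c_def m)
qed

text \<open>An orthogonal map carries a basis vector to \<open>e\<close> and leaves Lebesgue measure
  invariant.\<close>

lemma nn_integral_polar:
  fixes F :: "real \<Rightarrow> real \<Rightarrow> ennreal" and e :: "real^'n"
  assumes e: "norm e = 1" and dim: "CARD('n) \<ge> 2" and r: "r > 0"
    and F[measurable]: "case_prod F \<in> borel_measurable (borel \<Otimes>\<^sub>M borel)"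
  shows "(\<integral>\<^sup>+y. F (norm y) (y \<bullet> e) \<partial>lborel)
     = (\<integral>\<^sup>+\<tau>. \<integral>\<^sup>+k. ennreal (r ^ CARD('n) * ((CARD('n) - 1) * unit_ball_vol (CARD('n) - 1)) * \<tau> ^ (CARD('n) - 1)
            / sqrt (1 + k\<^sup>2) ^ CARD('n)) * indicator {0<..} \<tau>
          * F (r * \<tau>) (r * \<tau> * k / sqrt (1 + k\<^sup>2)) \<partial>lborel \<partial>lborel)"
proof -
  obtain b :: "real^'n" where b: "b \<in> Basis" by (meson nonempty_Basis ex_in_conv)
  obtain T where T: "orthogonal_transformation T" "T b = e"
    using orthogonal_transformation_exists[of b e] e b by auto
  have [measurable]: "T \<in> borel_measurable borel"
    using T(1) by (intro borel_measurable_continuous_onI linear_continuous_on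
        linear_conv_bounded_linear[THEN iffD1] orthogonal_transformation_linear)
  have "norm (T y) = norm y" "T y \<bullet> e = y \<bullet> b" for y
    using T by (auto simp: orthogonal_transformation_norm orthogonal_transformation_def)
  then have "(\<integral>\<^sup>+y. F (norm y) (y \<bullet> b) \<partial>lborel) = (\<integral>\<^sup>+y. F (norm (T y)) (T y \<bullet> e) \<partial>lborel)"
    by simp
  also have "\<dots> = (\<integral>\<^sup>+y. F (norm y) (y \<bullet> e) \<partial>distr lborel borel T)"
    by (rule nn_integral_distr[symmetric]) measurable
  also have "\<dots> = (\<integral>\<^sup>+y. F (norm y) (y \<bullet> e) \<partial>lborel)"
    by (simp only: distr_lborel_isometry[OF T(1)])
  finally show ?thesis
    by (rule trans[OF sym nn_integral_polar_basis[OF b _ r F, unfolded DIM_cart DIM_real mult_1_right, OF dim]])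
qed

section \<open>The angular kernel\<close>

text \<open>Law of cosines in units of \<open>r = norm x\<close>: the distance from \<open>x\<close>
  to a point \<open>y\<close> of norm \<open>r * \<tau>\<close>. Here \<open>k\<close> is the
  cotangent of the angle between \<open>y\<close> and \<open>- x\<close>, not \<open>x\<close>,
  hence the plus sign.\<close>

definition ang_dist :: "real \<Rightarrow> real \<Rightarrow> real" where
  "ang_dist \<tau> k = sqrt (1 + \<tau>\<^sup>2 + 2 * \<tau> * k / sqrt (1 + k\<^sup>2))"

text \<open>The kernel integrated over directions, without the area of the sphere in n-1 dimensions.
  With k = cot phi, the weight is sin^(n-2) phi dphi: the sine is
  \<open>1 / sqrt (1 + k\<^sup>2)\<close> and dphi contributes two further powers.\<close>

definition ang_ker :: "nat \<Rightarrow> real \<Rightarrow> real \<Rightarrow> real \<Rightarrow> real" where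
  "ang_ker n N \<delta> \<tau> = (\<integral>k. ang_dist \<tau> k powr (- N) / sqrt (1 + k\<^sup>2) ^ n * indicator {\<delta><..} (ang_dist \<tau> k) \<partial>lborel)"

lemma sqrt_1_plus_sq_pos: "sqrt (1 + k\<^sup>2) > (0::real)"
  by (simp add: add_pos_nonneg)

lemma abs_le_sqrt_1_plus_sq: "\<bar>k\<bar> \<le> sqrt (1 + k\<^sup>2)" for k :: real
  by (rule real_le_rsqrt) simp

lemma cot_cos_bound: "\<bar>k / sqrt (1 + k\<^sup>2)\<bar> \<le> 1" for k :: real
  using abs_le_sqrt_1_plus_sq[of k] sqrt_1_plus_sq_pos[of k] by simp

text \<open>Reverse triangle inequality; it decides for which \<open>\<tau>\<close> the truncation
  is felt at all.\<close>

lemma ang_dist_ge: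
  assumes "\<tau> \<ge> 0"
  shows "\<bar>\<tau> - 1\<bar> \<le> ang_dist \<tau> k"
  unfolding ang_dist_def
proof (rule real_le_rsqrt)
  have "\<tau> * (- 1) \<le> \<tau> * (k / sqrt (1 + k\<^sup>2))"
    using cot_cos_bound[of k] assms by (intro mult_left_mono) linarith+
  then show "\<bar>\<tau> - 1\<bar>\<^sup>2 \<le> 1 + \<tau>\<^sup>2 + 2 * \<tau> * k / sqrt (1 + k\<^sup>2)"
    by (simp add: power2_diff)
qed

lemma ang_dist_inverse:
  assumes "\<tau> > 0"
  shows "ang_dist (1 / \<tau>) k = ang_dist \<tau> k / \<tau>"
proof -
  have "1 + (1 / \<tau>)\<^sup>2 + 2 * (1 / \<tau>) * k / sqrt (1 + k\<^sup>2) = (1 + \<tau>\<^sup>2 + 2 * \<tau> * k / sqrt (1 + k\<^sup>2)) / \<tau>\<^sup>2"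
    using assms sqrt_1_plus_sq_pos[of k] by (simp add: field_simps power2_eq_square)
  then show ?thesis
    using assms by (simp add: ang_dist_def real_sqrt_divide)
qed

lemma ang_dist_nonneg: "\<tau> \<ge> 0 \<Longrightarrow> ang_dist \<tau> k \<ge> 0"
  using ang_dist_ge[of \<tau> k] by linarith

lemma ang_dist_measurable[measurable]: "ang_dist \<tau> \<in> borel_measurable borel"
  unfolding ang_dist_def[abs_def] by measurable

lemma integrable_inverse_1_plus_sq: "integrable lborel (\<lambda>k::real. 1 / (1 + k\<^sup>2))"
  using integrable_inverse_1_plus_square by (simp add: set_integrable_def divide_inverse)

text \<open>The lower bound \<open>m\<close> on the distance comes either from the truncation or
  from the gap between the two radii. One statement thus serves positive \<open>\<delta>\<close> at
  every \<open>\<tau>\<close> and also \<open>\<delta> = 0\<close> away from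
  \<open>\<tau> = 1\<close>. The condition \<open>n \<ge> 2\<close> makes the angular weight smaller
  than the integrable \<open>1 / (1 + k\<^sup>2)\<close>.\<close>

lemma ang_ker_bound_aux:
  assumes n: "n \<ge> 2" and N: "N \<ge> 0" and m: "m > 0" "m \<le> \<delta> \<or> (0 \<le> \<tau> \<and> m \<le> \<bar>\<tau> - 1\<bar>)"
  shows "\<bar>ang_dist \<tau> k powr (- N) / sqrt (1 + k\<^sup>2) ^ n * indicator {\<delta><..} (ang_dist \<tau> k)\<bar>
    \<le> m powr (- N) * (1 / (1 + k\<^sup>2))"
proof (cases "\<delta> < ang_dist \<tau> k")
  case True
  have "m \<le> ang_dist \<tau> k" using m(2) True ang_dist_ge[of \<tau> k] by linarith
  then have 1: "ang_dist \<tau> k powr (- N) \<le> m powr (- N)"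
    using N m by (intro powr_mono2') auto
  have "sqrt (1 + k\<^sup>2) ^ 2 \<le> sqrt (1 + k\<^sup>2) ^ n"
    using n by (intro power_increasing) auto
  then have "1 / sqrt (1 + k\<^sup>2) ^ n \<le> 1 / (1 + k\<^sup>2)"
    using sqrt_1_plus_sq_pos[of k] by (intro divide_left_mono) (auto simp: add_pos_nonneg)
  with 1 have "ang_dist \<tau> k powr (- N) * (1 / sqrt (1 + k\<^sup>2) ^ n) \<le> m powr (- N) * (1 / (1 + k\<^sup>2))"
    using sqrt_1_plus_sq_pos[of k] by (intro mult_mono) auto
  then show ?thesis using True sqrt_1_plus_sq_pos[of k] by simp
qed auto

lemma
  assumes n: "n \<ge> 2" and N: "N \<ge> 0" and m: "m > 0" "m \<le> \<delta> \<or> (0 \<le> \<tau> \<and> m \<le> \<bar>\<tau> - 1\<bar>)"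
  shows integrable_ang_ker: "integrable lborel
      (\<lambda>k. ang_dist \<tau> k powr (- N) / sqrt (1 + k\<^sup>2) ^ n * indicator {\<delta><..} (ang_dist \<tau> k))" (is ?A)
    and ang_ker_le: "ang_ker n N \<delta> \<tau> \<le> m powr (- N) * (\<integral>k. 1 / (1 + k\<^sup>2) \<partial>lborel)" (is ?B)
proof -
  note b = ang_ker_bound_aux[OF assms]
  have i: "integrable lborel (\<lambda>k::real. m powr (- N) * (1 / (1 + k\<^sup>2)))"
    using integrable_inverse_1_plus_sq by (rule integrable_mult_right)
  show A: ?A
    by (rule Bochner_Integration.integrable_bound[OF i]) (use b in \<open>auto intro!: AE_I2 order_trans[OF _ abs_ge_self]\<close>)
  have "ang_ker n N \<delta> \<tau> \<le> (\<integral>k. m powr (- N) * (1 / (1 + k\<^sup>2)) \<partial>lborel)"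
    unfolding ang_ker_def by (rule integral_mono[OF A i]) (use b abs_le_D1 in blast)
  then show ?B by (simp only: integral_mult_right_zero)
qed

lemma ang_ker_nonneg: "ang_ker n N \<delta> \<tau> \<ge> 0"
  unfolding ang_ker_def by (intro Bochner_Integration.integral_nonneg) auto

lemma ang_ker_antimono:
  assumes "n \<ge> 2" "N \<ge> 0" "\<tau> \<ge> 0" "\<tau> \<noteq> 1" "\<delta> \<le> \<delta>'"
  shows "ang_ker n N \<delta>' \<tau> \<le> ang_ker n N \<delta> \<tau>"
  unfolding ang_ker_def
  by (rule integral_mono; (rule integrable_ang_ker[where m="\<bar>\<tau> - 1\<bar>"])?)
     (use assms in \<open>auto simp: indicator_def\<close>)

text \<open>By \<open>ang_dist_ge\<close> every direction already lies beyond the threshold, so the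
  truncation removes nothing.\<close>

lemma ang_ker_eq_0:
  assumes "\<tau> \<ge> 0" "0 \<le> \<delta>" "\<delta> < \<bar>\<tau> - 1\<bar>"
  shows "ang_ker n N \<delta> \<tau> = ang_ker n N 0 \<tau>"
  unfolding ang_ker_def
proof (rule Bochner_Integration.integral_cong[OF refl])
  fix k :: real
  have "\<delta> < ang_dist \<tau> k" "0 < ang_dist \<tau> k" using ang_dist_ge[of \<tau> k] assms by linarith+
  then show "ang_dist \<tau> k powr (- N) / sqrt (1 + k\<^sup>2) ^ n * indicator {\<delta><..} (ang_dist \<tau> k)
    = ang_dist \<tau> k powr (- N) / sqrt (1 + k\<^sup>2) ^ n * indicator {0<..} (ang_dist \<tau> k)" by simp
qed

lemma ang_ker_inverse:
  assumes t: "\<tau> > 0"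
  shows "ang_ker n N \<delta> (1 / \<tau>) = \<tau> powr N * ang_ker n N (\<delta> * \<tau>) \<tau>"
  unfolding ang_ker_def integral_mult_right_zero[symmetric]
proof (rule Bochner_Integration.integral_cong[OF refl])
  fix k :: real
  show "ang_dist (1 / \<tau>) k powr (- N) / sqrt (1 + k\<^sup>2) ^ n * indicator {\<delta><..} (ang_dist (1 / \<tau>) k)
    = \<tau> powr N * (ang_dist \<tau> k powr (- N) / sqrt (1 + k\<^sup>2) ^ n * indicator {\<delta> * \<tau><..} (ang_dist \<tau> k))"
    using t ang_dist_nonneg[of \<tau> k]
    by (simp add: ang_dist_inverse indicator_def powr_divide powr_minus field_simps)
qed

text \<open>The threshold may vary with \<open>\<tau>\<close> because inversion produces
  \<open>\<delta> * \<tau>\<close>.\<close>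

lemma ang_ker_measurable[measurable]:
  assumes [measurable]: "f \<in> borel_measurable borel"
  shows "(\<lambda>\<tau>. ang_ker n N (f \<tau>) \<tau>) \<in> borel_measurable borel"
proof -
  have [measurable]: "Measurable.pred (borel \<Otimes>\<^sub>M lborel) (\<lambda>p. f (fst p) < ang_dist (fst p) (snd p))"
    unfolding ang_dist_def by measurable
  have [measurable]: "(\<lambda>p. ang_dist (fst p) (snd p)) \<in> borel_measurable (borel \<Otimes>\<^sub>M lborel)"
    unfolding ang_dist_def by measurable
  have "(\<lambda>p. ang_dist (fst p) (snd p) powr (- N) / sqrt (1 + (snd p)\<^sup>2) ^ n
      * (if f (fst p) < ang_dist (fst p) (snd p) then 1 else 0)) \<in> borel_measurable (borel \<Otimes>\<^sub>M lborel)"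
    by measurable
  then have "(\<lambda>(\<tau>, k). ang_dist \<tau> k powr (- N) / sqrt (1 + k\<^sup>2) ^ n * indicator {f \<tau><..} (ang_dist \<tau> k))
      \<in> borel_measurable (borel \<Otimes>\<^sub>M lborel)"
    by (simp add: indicator_def case_prod_unfold)
  then show ?thesis
    unfolding ang_ker_def by (rule lborel.borel_measurable_lebesgue_integral)
qed

text \<open>The polar formula applied to the indicator of a Borel set of radii. As an equality of
  measures it transfers integrability and integrals of signed radial functions without splitting
  into positive and negative parts.\<close>

lemma distr_radial_ang_ker:
  fixes x :: "real^'n" and N \<epsilon> :: real
  assumes dim: "CARD('n) \<ge> 2" and N: "N \<ge> 0" and x: "x \<noteq> 0" and \<epsilon>: "\<epsilon> > 0"
  defines "n \<equiv> CARD('n)" and "r \<equiv> norm x"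
  defines "c \<equiv> (CARD('n) - 1) * unit_ball_vol (CARD('n) - 1)"
  shows "distr (density lborel (\<lambda>y. ennreal (dist x y powr (- N) * indicator {\<epsilon><..} (dist x y)))) borel (\<lambda>y. norm y / r)
       = density lborel (\<lambda>\<tau>. ennreal (r ^ n * r powr (- N) * c * (indicator {0<..} \<tau> * \<tau> ^ (n - 1) * ang_ker n N (\<epsilon> / r) \<tau>)))"
    (is "?M1 = ?M2")
proof (rule measure_eqI)
  have r: "r > 0" using x by (simp add: r_def)
  have c: "c \<ge> 0" using dim by (simp add: c_def)
  define e where "e = - x /\<^sub>R r"
  have e: "norm e = 1" using r by (simp add: e_def r_def)
  have dist: "dist x y = sqrt (r\<^sup>2 + (norm y)\<^sup>2 + 2 * r * (y \<bullet> e))" for y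
  proof -
    have "(dist x y)\<^sup>2 = r\<^sup>2 + (norm y)\<^sup>2 + 2 * r * (y \<bullet> e)"
      using r by (simp add: dist_norm r_def e_def power2_norm_eq_inner inner_diff_left inner_diff_right
          inner_commute algebra_simps)
    then show ?thesis by (metis real_sqrt_abs abs_of_nonneg zero_le_dist)
  qed
  define W where "W d = d powr (- N) * indicator {\<epsilon><..} d" for d
  have [measurable]: "W \<in> borel_measurable borel" unfolding W_def[abs_def] by measurable
  show "sets ?M1 = sets ?M2" by simp
  fix S assume "S \<in> sets ?M1"
  then have S[measurable]: "S \<in> sets borel" by simp
  define F where "F \<rho> t = indicator S (\<rho> / r) * ennreal (W (sqrt (r\<^sup>2 + \<rho>\<^sup>2 + 2 * r * t)))" for \<rho> t
  have F[measurable]: "case_prod F \<in> borel_measurable (borel \<Otimes>\<^sub>M borel)"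
    unfolding F_def[abs_def] by measurable
  have "emeasure ?M1 S = (\<integral>\<^sup>+y. indicator S (norm y / r) \<partial>density lborel (\<lambda>y. ennreal (W (dist x y))))"
    by (subst nn_integral_indicator[symmetric], simp, subst nn_integral_distr) (simp_all add: W_def)
  also have "\<dots> = (\<integral>\<^sup>+y. F (norm y) (y \<bullet> e) \<partial>lborel)"
    by (subst nn_integral_density) (auto simp: F_def dist mult.commute)
  also have "\<dots> = (\<integral>\<^sup>+\<tau>. \<integral>\<^sup>+k. ennreal (r ^ n * c * \<tau> ^ (n - 1) / sqrt (1 + k\<^sup>2) ^ n) * indicator {0<..} \<tau>
          * F (r * \<tau>) (r * \<tau> * k / sqrt (1 + k\<^sup>2)) \<partial>lborel \<partial>lborel)"
    unfolding n_def c_def by (rule nn_integral_polar[OF e dim r F])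
  also have "\<dots> = (\<integral>\<^sup>+\<tau>. ennreal (r ^ n * r powr (- N) * c * (indicator {0<..} \<tau> * \<tau> ^ (n - 1) * ang_ker n N (\<epsilon> / r) \<tau>))
      * indicator S \<tau> \<partial>lborel)"
  proof (rule nn_integral_cong)
    fix \<tau> :: real
    let ?q = "\<lambda>k. ang_dist \<tau> k powr (- N) / sqrt (1 + k\<^sup>2) ^ n * indicator {\<epsilon> / r<..} (ang_dist \<tau> k)"
    show "(\<integral>\<^sup>+k. ennreal (r ^ n * c * \<tau> ^ (n - 1) / sqrt (1 + k\<^sup>2) ^ n) * indicator {0<..} \<tau>
          * F (r * \<tau>) (r * \<tau> * k / sqrt (1 + k\<^sup>2)) \<partial>lborel)
       = ennreal (r ^ n * r powr (- N) * c * (indicator {0<..} \<tau> * \<tau> ^ (n - 1) * ang_ker n N (\<epsilon> / r) \<tau>)) * indicator S \<tau>"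
    proof (cases "\<tau> > 0 \<and> \<tau> \<in> S")
      case True
      then have t: "\<tau> > 0" "\<tau> \<in> S" by auto
      define K where "K = r ^ n * r powr (- N) * c * \<tau> ^ (n - 1)"
      have K: "K \<ge> 0" using r c t by (simp add: K_def)
      have W: "W (sqrt (r\<^sup>2 + (r * \<tau>)\<^sup>2 + 2 * r * (r * \<tau> * k / sqrt (1 + k\<^sup>2))))
          = r powr (- N) * (ang_dist \<tau> k powr (- N) * indicator {\<epsilon> / r<..} (ang_dist \<tau> k))" for k
      proof -
        have "r\<^sup>2 + (r * \<tau>)\<^sup>2 + 2 * r * (r * \<tau> * k / sqrt (1 + k\<^sup>2)) = r\<^sup>2 * (1 + \<tau>\<^sup>2 + 2 * \<tau> * k / sqrt (1 + k\<^sup>2))"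
          by (simp add: algebra_simps power2_eq_square)
        then have "sqrt (r\<^sup>2 + (r * \<tau>)\<^sup>2 + 2 * r * (r * \<tau> * k / sqrt (1 + k\<^sup>2))) = r * ang_dist \<tau> k"
          using r by (simp add: ang_dist_def real_sqrt_mult)
        then show ?thesis
          using r ang_dist_nonneg[of \<tau> k] t
          by (simp add: W_def powr_mult indicator_def field_simps)
      qed
      have int: "integrable lborel ?q"
        using dim N \<epsilon> r unfolding n_def by (intro integrable_ang_ker[where m = "\<epsilon> / r"]) auto
      have "(\<integral>\<^sup>+k. ennreal (r ^ n * c * \<tau> ^ (n - 1) / sqrt (1 + k\<^sup>2) ^ n) * indicator {0<..} \<tau>
          * F (r * \<tau>) (r * \<tau> * k / sqrt (1 + k\<^sup>2)) \<partial>lborel) = (\<integral>\<^sup>+k. ennreal (K * ?q k) \<partial>lborel)"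
      proof (rule nn_integral_cong)
        fix k :: real
        have "(r ^ n * c * \<tau> ^ (n - 1) / sqrt (1 + k\<^sup>2) ^ n)
            * W (sqrt (r\<^sup>2 + (r * \<tau>)\<^sup>2 + 2 * r * (r * \<tau> * k / sqrt (1 + k\<^sup>2)))) = K * ?q k"
          unfolding W K_def by simp
        moreover have "0 \<le> r ^ n * c * \<tau> ^ (n - 1) / sqrt (1 + k\<^sup>2) ^ n" using r c t by simp
        moreover have "F (r * \<tau>) (r * \<tau> * k / sqrt (1 + k\<^sup>2))
            = ennreal (W (sqrt (r\<^sup>2 + (r * \<tau>)\<^sup>2 + 2 * r * (r * \<tau> * k / sqrt (1 + k\<^sup>2)))))"
          using t r by (simp add: F_def)
        ultimately show "ennreal (r ^ n * c * \<tau> ^ (n - 1) / sqrt (1 + k\<^sup>2) ^ n) * indicator {0<..} \<tau>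
          * F (r * \<tau>) (r * \<tau> * k / sqrt (1 + k\<^sup>2)) = ennreal (K * ?q k)"
          using t by (simp only: ennreal_mult'[symmetric] indicator_simps greaterThan_iff mult_1_right)
      qed
      also have "\<dots> = ennreal (\<integral>k. K * ?q k \<partial>lborel)"
        by (rule nn_integral_eq_integral[OF integrable_mult_right[OF int]]) (use K in auto)
      also have "(\<integral>k. K * ?q k \<partial>lborel) = K * ang_ker n N (\<epsilon> / r) \<tau>"
        unfolding ang_ker_def by (rule integral_mult_right_zero)
      finally show ?thesis using t by (simp add: K_def mult_ac)
    next
      case False
      then have "indicator {0<..} \<tau> * (indicator S \<tau> :: ennreal) = 0" "indicator {0<..} \<tau> = (0::real) \<or> indicator S \<tau> = (0::ennreal)"
        by (auto simp: indicator_def)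
      then show ?thesis using r by (auto simp: F_def)
    qed
  qed
  also have "\<dots> = emeasure ?M2 S"
    by (subst emeasure_density) auto
  finally show "emeasure ?M1 S = emeasure ?M2 S" .
qed

lemma
  fixes x :: "real^'n" and N \<epsilon> :: real
  assumes dim: "CARD('n) \<ge> 2" and N: "N \<ge> 0" and x: "x \<noteq> 0" and \<epsilon>: "\<epsilon> > 0"
    and h[measurable]: "h \<in> borel_measurable borel"
  defines "n \<equiv> CARD('n)" and "r \<equiv> norm x"
  defines "c \<equiv> (CARD('n) - 1) * unit_ball_vol (CARD('n) - 1)"
  assumes int: "integrable lborel (\<lambda>\<tau>. h \<tau> * (indicator {0<..} \<tau> * \<tau> ^ (n - 1) * ang_ker n N (\<epsilon> / r) \<tau>))"
  shows integrable_radial_ang_ker: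
      "integrable lborel (\<lambda>y. h (norm y / r) * (dist x y powr (- N) * indicator {\<epsilon><..} (dist x y)))" (is ?A)
    and integral_radial_ang_ker:
      "(\<integral>y. h (norm y / r) * (dist x y powr (- N) * indicator {\<epsilon><..} (dist x y)) \<partial>lborel)
        = r ^ n * r powr (- N) * c * (\<integral>\<tau>. h \<tau> * (indicator {0<..} \<tau> * \<tau> ^ (n - 1) * ang_ker n N (\<epsilon> / r) \<tau>) \<partial>lborel)" (is ?B)
proof -
  note D = distr_radial_ang_ker[OF dim N x \<epsilon>, folded n_def r_def c_def]
  let ?w = "\<lambda>y. dist x y powr (- N) * indicator {\<epsilon><..} (dist x y)"
  let ?v = "\<lambda>\<tau>. indicator {0<..} \<tau> * \<tau> ^ (n - 1) * ang_ker n N (\<epsilon> / r) \<tau>"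
  let ?M = "density lborel (\<lambda>y. ennreal (?w y)) :: (real^'n) measure"
  let ?C = "r ^ n * r powr (- N) * c"
  have C: "?C \<ge> 0" using dim by (simp add: c_def r_def)
  have v: "?v \<tau> \<ge> 0" for \<tau> using ang_ker_nonneg[of n N "\<epsilon> / r" \<tau>] by (auto simp: indicator_def)
  have [measurable]: "(\<lambda>\<tau>. ang_ker n N (\<epsilon> / r) \<tau>) \<in> borel_measurable borel" by (rule ang_ker_measurable) simp
  have "integrable lborel (\<lambda>\<tau>. ?C * (h \<tau> * ?v \<tau>))"
    using int by (rule integrable_mult_right)
  then have "integrable lborel (\<lambda>\<tau>. (?C * ?v \<tau>) *\<^sub>R h \<tau>)"
    by (simp add: mult_ac)
  then have "integrable (density lborel (\<lambda>\<tau>. ennreal (?C * ?v \<tau>))) h"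
    using C v by (subst integrable_density) (auto intro!: AE_I2)
  then have "integrable (distr ?M borel (\<lambda>y. norm y / r)) h"
    by (simp only: D)
  then have i: "integrable ?M (\<lambda>y. h (norm y / r))"
    by (subst (asm) integrable_distr_eq) auto
  then show ?A by (subst (asm) integrable_density) (auto simp: mult_ac)
  have "(\<integral>y. h (norm y / r) * ?w y \<partial>lborel) = (\<integral>y. h (norm y / r) \<partial>?M)"
    by (subst integral_density) (auto simp: mult_ac)
  also have "\<dots> = (\<integral>\<tau>. h \<tau> \<partial>distr ?M borel (\<lambda>y. norm y / r))"
    by (subst integral_distr) auto
  also have "\<dots> = (\<integral>\<tau>. h \<tau> \<partial>density lborel (\<lambda>\<tau>. ennreal (?C * ?v \<tau>)))"
    by (simp only: D)
  also have "\<dots> = (\<integral>\<tau>. (?C * ?v \<tau>) *\<^sub>R h \<tau> \<partial>lborel)"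
    using C v by (subst integral_density) (auto intro!: AE_I2)
  also have "\<dots> = (\<integral>\<tau>. ?C * (h \<tau> * ?v \<tau>) \<partial>lborel)" by (simp add: mult_ac)
  also have "\<dots> = ?C * (\<integral>\<tau>. h \<tau> * ?v \<tau> \<partial>lborel)" by (rule integral_mult_right_zero)
  finally show ?B .
qed

section \<open>Projecting the sphere from a point: the function H\<close>

text \<open>The ray from the unit vector at angle \<open>\<theta>\<close> hits the sphere of radius \<open>\<tau> > 1\<close> at distance
  \<open>sqrt (\<tau>\<^sup>2 - sin\<^sup>2 \<theta>) - cos \<theta> = (\<tau>\<^sup>2 - 1) / (sqrt (\<tau>\<^sup>2 - sin\<^sup>2 \<theta>) + cos \<theta>)\<close>; \<open>ray_cot\<close> is
  minus the cotangent of the angle under which the hitting point is seen from the origin.\<close>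
definition ray_cot :: "real \<Rightarrow> real \<Rightarrow> real" where
  "ray_cot \<tau> \<theta> = - (sqrt (\<tau>\<^sup>2 - (sin \<theta>)\<^sup>2) + \<tau>\<^sup>2 * cos \<theta>) / ((\<tau>\<^sup>2 - 1) * sin \<theta>)"

lemma ray_sqrt:
  fixes \<tau> \<theta> :: real
  assumes "\<tau> > 1"
  shows "\<tau>\<^sup>2 - (sin \<theta>)\<^sup>2 > 0" "sqrt (\<tau>\<^sup>2 - (sin \<theta>)\<^sup>2) > 0" "sqrt (\<tau>\<^sup>2 - (sin \<theta>)\<^sup>2) > \<bar>cos \<theta>\<bar>"
    "sqrt (\<tau>\<^sup>2 - (sin \<theta>)\<^sup>2) \<le> \<tau>" "\<tau>\<^sup>2 > 1" "sqrt (\<tau>\<^sup>2 - (sin \<theta>)\<^sup>2) + cos \<theta> > 0"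
proof -
  show t: "\<tau>\<^sup>2 > 1" using assms by simp
  have c: "(sin \<theta>)\<^sup>2 + (cos \<theta>)\<^sup>2 = 1" by simp
  show pos: "\<tau>\<^sup>2 - (sin \<theta>)\<^sup>2 > 0" using t c zero_le_power2[of "cos \<theta>"] by linarith
  then show "sqrt (\<tau>\<^sup>2 - (sin \<theta>)\<^sup>2) > 0" by simp
  show gt: "sqrt (\<tau>\<^sup>2 - (sin \<theta>)\<^sup>2) > \<bar>cos \<theta>\<bar>" using t by (intro real_less_rsqrt) (simp add: cos_squared_eq)
  show "sqrt (\<tau>\<^sup>2 - (sin \<theta>)\<^sup>2) \<le> \<tau>" using assms by (intro real_le_lsqrt) auto
  show "sqrt (\<tau>\<^sup>2 - (sin \<theta>)\<^sup>2) + cos \<theta> > 0" using gt by linarith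
qed

lemma ray_cot_deriv:
  assumes t: "\<tau> > 1" and th: "0 < \<theta>" "\<theta> < pi"
  shows "(ray_cot \<tau> has_real_derivative
    \<tau>\<^sup>2 * (sqrt (\<tau>\<^sup>2 - (sin \<theta>)\<^sup>2) + cos \<theta>) / (sqrt (\<tau>\<^sup>2 - (sin \<theta>)\<^sup>2) * (\<tau>\<^sup>2 - 1) * (sin \<theta>)\<^sup>2)) (at \<theta>)"
proof -
  define S where "S = sqrt (\<tau>\<^sup>2 - (sin \<theta>)\<^sup>2)"
  have S: "S > 0" "S\<^sup>2 = \<tau>\<^sup>2 - (sin \<theta>)\<^sup>2" using ray_sqrt(1-4,6)[OF t, of \<theta>] by (auto simp: S_def)
  have s: "sin \<theta> > 0" using th by (rule sin_gt_zero)
  have m: "\<tau>\<^sup>2 - 1 > 0" using ray_sqrt(5)[OF t] by simp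
  have "((\<lambda>\<theta>. \<tau>\<^sup>2 - (sin \<theta>)\<^sup>2) has_real_derivative - (2 * sin \<theta> * cos \<theta>)) (at \<theta>)"
    by (auto intro!: derivative_eq_intros)
  from DERIV_chain2[OF DERIV_real_sqrt[OF ray_sqrt(1)[OF t]] this]
  have D: "((\<lambda>\<theta>. sqrt (\<tau>\<^sup>2 - (sin \<theta>)\<^sup>2)) has_real_derivative - (sin \<theta> * cos \<theta>) / S) (at \<theta>)"
    by (simp add: S_def field_simps)
  have num: "((\<lambda>\<theta>. - (sqrt (\<tau>\<^sup>2 - (sin \<theta>)\<^sup>2) + \<tau>\<^sup>2 * cos \<theta>)) has_real_derivative
      - (- (sin \<theta> * cos \<theta>) / S + \<tau>\<^sup>2 * (- sin \<theta>))) (at \<theta>)"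
    by (intro DERIV_minus DERIV_add D DERIV_cmult DERIV_cos)
  have den: "((\<lambda>\<theta>. (\<tau>\<^sup>2 - 1) * sin \<theta>) has_real_derivative (\<tau>\<^sup>2 - 1) * cos \<theta>) (at \<theta>)"
    by (intro DERIV_cmult DERIV_sin)
  \<comment> \<open>The numerator of the quotient rule collapses in two steps: first
    \<open>s\<^sup>2 + C\<^sup>2 = 1\<close>, then \<open>S\<^sup>2 + s\<^sup>2 = T\<close>, with
    \<open>T\<close> standing for \<open>\<tau>\<^sup>2\<close>.\<close>
  have alg: "((- (- (s * C) / S + T * (- s))) * (m * s) - (- (S + T * C)) * (m * C)) / ((m * s) * (m * s))
    = T * (S + C) / (S * m * s\<^sup>2)"
    if "s > 0" "m > 0" "S\<^sup>2 = T - s\<^sup>2" "s\<^sup>2 + C\<^sup>2 = 1" for s C T m :: real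
  proof -
    have "(- (- (s * C) / S + T * (- s))) * (m * s) - (- (S + T * C)) * (m * C)
      = m * (C / S * s\<^sup>2 + S * C + T * (s\<^sup>2 + C\<^sup>2))"
      by (simp add: algebra_simps power2_eq_square)
    also have "C / S * s\<^sup>2 + S * C + T * (s\<^sup>2 + C\<^sup>2) = C / S * (s\<^sup>2 + S\<^sup>2) + T"
      unfolding that(4) using S(1) by (simp add: distrib_left power2_eq_square)
    also have "\<dots> = T * (S + C) / S"
      unfolding that(3) using S(1) by (simp add: field_simps)
    finally show ?thesis using that(1,2) S(1) by (simp add: power2_eq_square)
  qed
  have "(sin \<theta>)\<^sup>2 + (cos \<theta>)\<^sup>2 = 1" by simp
  from DERIV_divide[OF num den] alg[OF s m S(2) this] s m
  show ?thesis unfolding ray_cot_def[abs_def] S_def by simp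
qed

text \<open>Consider the triangle formed by the origin, the unit vector and the hitting point. The
  first formula is its law of sines, as the sine of the angle at the origin is
  \<open>1 / sqrt (1 + k\<^sup>2)\<close>; the second is the length of the ray.\<close>

lemma
  assumes t: "\<tau> > 1" and th: "0 < \<theta>" "\<theta> < pi"
  shows sqrt_1_ray_cot: "sqrt (1 + (ray_cot \<tau> \<theta>)\<^sup>2)
      = \<tau> * (sqrt (\<tau>\<^sup>2 - (sin \<theta>)\<^sup>2) + cos \<theta>) / ((\<tau>\<^sup>2 - 1) * sin \<theta>)"
    and ang_dist_ray_cot: "ang_dist \<tau> (ray_cot \<tau> \<theta>) = (\<tau>\<^sup>2 - 1) / (sqrt (\<tau>\<^sup>2 - (sin \<theta>)\<^sup>2) + cos \<theta>)"
proof -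
  define S where "S = sqrt (\<tau>\<^sup>2 - (sin \<theta>)\<^sup>2)"
  define C where "C = cos \<theta>"
  define s where "s = sin \<theta>"
  have s: "s > 0" using th by (simp add: s_def sin_gt_zero)
  have c: "s\<^sup>2 = 1 - C\<^sup>2" by (simp add: s_def C_def sin_squared_eq)
  have S: "S > 0" "S\<^sup>2 = \<tau>\<^sup>2 - 1 + C\<^sup>2" "S + C > 0" using ray_sqrt(1-4,6)[OF t, of \<theta>]
    by (auto simp: S_def C_def s_def[symmetric] c)
  have m: "\<tau>\<^sup>2 - 1 > 0" using ray_sqrt(5)[OF t] by simp
  have k: "ray_cot \<tau> \<theta> = - (S + \<tau>\<^sup>2 * C) / ((\<tau>\<^sup>2 - 1) * s)" by (simp add: ray_cot_def S_def C_def s_def)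
  have "1 + (ray_cot \<tau> \<theta>)\<^sup>2 = (((\<tau>\<^sup>2 - 1)\<^sup>2 * s\<^sup>2) + (S + \<tau>\<^sup>2 * C)\<^sup>2) / ((\<tau>\<^sup>2 - 1) * s)\<^sup>2"
    using s m unfolding k power_divide power2_minus by (simp add: add_divide_distrib power_mult_distrib)
  also have "((\<tau>\<^sup>2 - 1)\<^sup>2 * s\<^sup>2) + (S + \<tau>\<^sup>2 * C)\<^sup>2 = (\<tau> * (S + C))\<^sup>2"
  proof -
    have "((\<tau>\<^sup>2 - 1)\<^sup>2 * (1 - C\<^sup>2)) + (S\<^sup>2 + 2 * S * \<tau>\<^sup>2 * C + (\<tau>\<^sup>2)\<^sup>2 * C\<^sup>2) = \<tau>\<^sup>2 * (S\<^sup>2 + 2 * S * C + C\<^sup>2)"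
      unfolding S(2) by algebra
    then show ?thesis unfolding c by (simp add: power2_sum power_mult_distrib mult_ac add_ac)
  qed
  also have "(\<tau> * (S + C))\<^sup>2 / ((\<tau>\<^sup>2 - 1) * s)\<^sup>2 = (\<tau> * (S + C) / ((\<tau>\<^sup>2 - 1) * s))\<^sup>2"
    by (simp add: power_divide)
  finally have 1: "sqrt (1 + (ray_cot \<tau> \<theta>)\<^sup>2) = \<tau> * (S + C) / ((\<tau>\<^sup>2 - 1) * s)"
    using t S s m by (simp add: real_sqrt_abs)
  then show "sqrt (1 + (ray_cot \<tau> \<theta>)\<^sup>2) = \<tau> * (sqrt (\<tau>\<^sup>2 - (sin \<theta>)\<^sup>2) + cos \<theta>) / ((\<tau>\<^sup>2 - 1) * sin \<theta>)"
    by (simp add: S_def C_def s_def)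
  have "\<tau> * ray_cot \<tau> \<theta> / sqrt (1 + (ray_cot \<tau> \<theta>)\<^sup>2) = - (S + \<tau>\<^sup>2 * C) / (S + C)"
  proof -
    have "\<tau> * (- A / (M * s)) / (\<tau> * X / (M * s)) = - A / X" if "M > 0" for A M X
      using that t s by simp
    from this[OF m] show ?thesis unfolding 1 unfolding k .
  qed
  moreover have "2 * \<tau> * K / W = 2 * (\<tau> * K / W)" for K W :: real by simp
  ultimately have "1 + \<tau>\<^sup>2 + 2 * \<tau> * ray_cot \<tau> \<theta> / sqrt (1 + (ray_cot \<tau> \<theta>)\<^sup>2) = 1 + \<tau>\<^sup>2 + 2 * (- (S + \<tau>\<^sup>2 * C) / (S + C))"
    by (simp only:)
  also have "\<dots> = 1 + \<tau>\<^sup>2 - 2 * ((S + \<tau>\<^sup>2 * C) / (S + C))"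
    by (simp only: minus_divide_left[symmetric] mult_minus_right add_uminus_conv_diff)
  \<comment> \<open>Extending the fraction by \<open>S + C\<close> produces the difference of
    squares \<open>S\<^sup>2 - C\<^sup>2\<close>, which equals
    \<open>\<tau>\<^sup>2 - 1\<close>.\<close>
  also have "\<dots> = ((1 + \<tau>\<^sup>2) * (S + C) - 2 * (S + \<tau>\<^sup>2 * C)) * (S + C) / (S + C)\<^sup>2"
  proof -
    have "a - 2 * (A / X) = (a * X - 2 * A) * X / X\<^sup>2" if "X > 0" for a A X :: real
      using that by (simp add: field_simps power2_eq_square)
    then show ?thesis using S(3) .
  qed
  also have "((1 + \<tau>\<^sup>2) * (S + C) - 2 * (S + \<tau>\<^sup>2 * C)) * (S + C) = (\<tau>\<^sup>2 - 1) * (S\<^sup>2 - C\<^sup>2)"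
    by algebra
  also have "\<dots> = (\<tau>\<^sup>2 - 1)\<^sup>2" by (simp only: S(2) power2_eq_square[of "\<tau>\<^sup>2 - 1"]) simp
  finally have "ang_dist \<tau> (ray_cot \<tau> \<theta>) = (\<tau>\<^sup>2 - 1) / (S + C)"
    using m S by (simp add: ang_dist_def real_sqrt_divide)
  then show "ang_dist \<tau> (ray_cot \<tau> \<theta>) = (\<tau>\<^sup>2 - 1) / (sqrt (\<tau>\<^sup>2 - (sin \<theta>)\<^sup>2) + cos \<theta>)"
    by (simp add: S_def C_def)
qed

text \<open>The numerator stays positive in absolute value at both ends, with limits of opposite
  sign, while the sine tends to 0. With the positive derivative this makes \<open>ray_cot\<close> an
  increasing substitution from (0, pi) onto the whole line.\<close>

lemma ray_cot_limits:
  assumes t: "\<tau> > 1"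
  shows "filterlim (ray_cot \<tau>) at_bot (at_right 0)" "filterlim (ray_cot \<tau>) at_top (at_left pi)"
proof -
  have m: "\<tau>\<^sup>2 - 1 > 0" using ray_sqrt(5)[OF t] by simp
  have r: "eventually (\<lambda>\<theta>. 0 < sin \<theta>) (at_right (0::real))"
    using eventually_at_right_real[OF pi_gt_zero] by eventually_elim (auto intro: sin_gt_zero)
  have l: "eventually (\<lambda>\<theta>. 0 < sin \<theta>) (at_left pi)"
    using eventually_at_left_real[OF pi_gt_zero] by eventually_elim (auto intro: sin_gt_zero)
  have "filterlim (\<lambda>\<theta>. (sqrt (\<tau>\<^sup>2 - (sin \<theta>)\<^sup>2) + \<tau>\<^sup>2 * cos \<theta>) / ((\<tau>\<^sup>2 - 1) * sin \<theta>)) at_top (at_right 0)"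
  proof (rule LIM_at_top_divide)
    show "((\<lambda>\<theta>. sqrt (\<tau>\<^sup>2 - (sin \<theta>)\<^sup>2) + \<tau>\<^sup>2 * cos \<theta>) \<longlongrightarrow> sqrt (\<tau>\<^sup>2 - (sin 0)\<^sup>2) + \<tau>\<^sup>2 * cos 0) (at_right 0)"
      by (intro tendsto_intros)
    show "0 < sqrt (\<tau>\<^sup>2 - (sin 0)\<^sup>2) + \<tau>\<^sup>2 * cos 0" using t by (simp add: add_pos_pos)
    have "((\<lambda>\<theta>. (\<tau>\<^sup>2 - 1) * sin \<theta>) \<longlongrightarrow> (\<tau>\<^sup>2 - 1) * sin 0) (at_right 0)" by (intro tendsto_intros)
    then show "((\<lambda>\<theta>. (\<tau>\<^sup>2 - 1) * sin \<theta>) \<longlongrightarrow> 0) (at_right 0)" by simp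
    show "\<forall>\<^sub>F \<theta> in at_right 0. 0 < (\<tau>\<^sup>2 - 1) * sin \<theta>" using r by eventually_elim (use m in auto)
  qed
  then show "filterlim (ray_cot \<tau>) at_bot (at_right 0)"
    unfolding filterlim_uminus_at_bot ray_cot_def by (simp only: minus_divide_left[symmetric] minus_minus)
  show "filterlim (ray_cot \<tau>) at_top (at_left pi)"
    unfolding ray_cot_def[abs_def]
  proof (rule LIM_at_top_divide)
    show "((\<lambda>\<theta>. - (sqrt (\<tau>\<^sup>2 - (sin \<theta>)\<^sup>2) + \<tau>\<^sup>2 * cos \<theta>)) \<longlongrightarrow> - (sqrt (\<tau>\<^sup>2 - (sin pi)\<^sup>2) + \<tau>\<^sup>2 * cos pi)) (at_left pi)"
      by (intro tendsto_intros)
    show "0 < - (sqrt (\<tau>\<^sup>2 - (sin pi)\<^sup>2) + \<tau>\<^sup>2 * cos pi)" using t by (simp add: power2_eq_square)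
    have "((\<lambda>\<theta>. (\<tau>\<^sup>2 - 1) * sin \<theta>) \<longlongrightarrow> (\<tau>\<^sup>2 - 1) * sin pi) (at_left pi)" by (intro tendsto_intros)
    then show "((\<lambda>\<theta>. (\<tau>\<^sup>2 - 1) * sin \<theta>) \<longlongrightarrow> 0) (at_left pi)" by simp
    show "\<forall>\<^sub>F \<theta> in at_left pi. 0 < (\<tau>\<^sup>2 - 1) * sin \<theta>" using l by eventually_elim (use m in auto)
  qed
qed


text \<open>Both sides are the surface area of the unit sphere in R^(n-1); the functional equation
  of Gamma converts one form into the other.\<close>

lemma unit_ball_vol_eq_alpha_n:
  assumes "n \<ge> 2"
  shows "real (n - 1) * unit_ball_vol (real (n - 1)) = 2 * pi * alpha_n n"
proof -
  define m where "m = real (n - 1)"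
  have m: "m > 0" "real n - 1 = m" "real n - 3 = m - 2" using assms by (auto simp: m_def of_nat_diff)
  have G: "Gamma (m / 2 + 1) = m / 2 * Gamma (m / 2)"
    using m by (intro Gamma_plus1) (auto elim: nonpos_Ints_cases)
  have "Gamma (m / 2) > 0" using m by (intro Gamma_real_pos) auto
  moreover have "pi powr (m / 2) = pi * pi powr ((m - 2) / 2)"
    by (simp add: diff_divide_distrib powr_diff)
  ultimately show ?thesis
    using m by (simp add: alpha_n_def unit_ball_vol_def m_def[symmetric] G)
qed

context
  fixes s \<tau> :: real and n :: nat
  assumes s: "0 < s" and n: "n \<ge> 2" and t: "\<tau> > 1"
begin

definition H_integrand :: "real \<Rightarrow> real" where
  "H_integrand \<theta> = sin \<theta> ^ (n - 2) * (sqrt (\<tau>\<^sup>2 - (sin \<theta>)\<^sup>2) + cos \<theta>) powr (1 + 2 * s)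
        / sqrt (\<tau>\<^sup>2 - (sin \<theta>)\<^sup>2)"

lemma continuous_on_H_integrand: "continuous_on {0..pi} H_integrand"
proof -
  have "sqrt (\<tau>\<^sup>2 - (sin \<theta>)\<^sup>2) + cos \<theta> \<noteq> 0" "sqrt (\<tau>\<^sup>2 - (sin \<theta>)\<^sup>2) \<noteq> 0" for \<theta>
    using ray_sqrt(2,6)[OF t, of \<theta>] by auto
  then show ?thesis unfolding H_integrand_def[abs_def] by (intro continuous_intros) auto
qed

lemma set_integrable_H_integrand: "set_integrable lborel {0..pi} H_integrand"
  unfolding set_integrable_def by (intro borel_integrable_compact continuous_on_H_integrand) auto

lemma H_fun_eq: "H_fun s n \<tau> = 2 * pi * alpha_n n * integral {0..pi} H_integrand"
  by (simp add: H_fun_def H_integrand_def[abs_def])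

text \<open>Write \<open>q = m / X\<close> for the ray length. The n-th powers of
  \<open>X / m\<close> in the kernel and in the angular weight cancel, leaving the n-th power of sin
  \<theta> / \<tau>. The derivative removes two sines and adds one factor \<open>X\<close>, whence
  the exponents n-2 and 1+2s in \<open>H\<close>.\<close>

lemma ray_cot_substitution:
  assumes th: "0 < \<theta>" "\<theta> < pi"
  shows "ang_dist \<tau> (ray_cot \<tau> \<theta>) powr (- (real n + 2 * s)) / sqrt (1 + (ray_cot \<tau> \<theta>)\<^sup>2) ^ n
      * (\<tau>\<^sup>2 * (sqrt (\<tau>\<^sup>2 - (sin \<theta>)\<^sup>2) + cos \<theta>) / (sqrt (\<tau>\<^sup>2 - (sin \<theta>)\<^sup>2) * (\<tau>\<^sup>2 - 1) * (sin \<theta>)\<^sup>2))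
    = (\<tau>\<^sup>2 - 1) powr (- 1 - 2 * s) * \<tau>\<^sup>2 / \<tau> ^ n * H_integrand \<theta>"
proof -
  define S where "S = sqrt (\<tau>\<^sup>2 - (sin \<theta>)\<^sup>2)"
  define X where "X = S + cos \<theta>"
  define m where "m = \<tau>\<^sup>2 - 1"
  define z where "z = sin \<theta>"
  have pos: "S > 0" "X > 0" "m > 0" "z > 0" "\<tau> > 0"
    using ray_sqrt(2,6)[OF t, of \<theta>] ray_sqrt(5)[OF t] th t by (auto simp: S_def X_def m_def z_def sin_gt_zero)
  obtain j where j: "n = j + 2" using n by (metis le_add_diff_inverse2)
  have "(m / X) powr (- p) = (X / m) powr p" for p
    using pos by (simp add: powr_minus_divide powr_divide)
  then have "(m / X) powr (- (real n + 2 * s)) = (X / m) powr (real n + 2 * s)" .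
  also have "\<dots> = (X / m) ^ n * (X powr (2 * s) / m powr (2 * s))"
    using pos by (simp add: powr_add powr_realpow[symmetric] powr_divide)
  finally have "(m / X) powr (- (real n + 2 * s)) / (\<tau> * X / (m * z)) ^ n
      = ((X / m) / (\<tau> * X / (m * z))) ^ n * (X powr (2 * s) / m powr (2 * s))"
    by (simp only: power_divide[of "X / m"]) simp
  also have "(X / m) / (\<tau> * X / (m * z)) = z / \<tau>"
    using pos by (simp add: field_simps)
  also have "(z / \<tau>) ^ n = z ^ j * z\<^sup>2 / \<tau> ^ n"
    by (simp add: j power_divide power_add power2_eq_square)
  finally have "(m / X) powr (- (real n + 2 * s)) / (\<tau> * X / (m * z)) ^ n * (\<tau>\<^sup>2 * X / (S * m * z\<^sup>2))
     = (z ^ j * z\<^sup>2 / \<tau> ^ n) * (X powr (2 * s) / m powr (2 * s)) * (\<tau>\<^sup>2 * X / (S * m * z\<^sup>2))"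
    by (simp only:)
  also have "\<dots> = (X * X powr (2 * s)) * (1 / (m powr (2 * s) * m)) * \<tau>\<^sup>2 / \<tau> ^ n * z ^ j / S"
    using pos by (simp add: mult_ac)
  also have "X * X powr (2 * s) = X powr (1 + 2 * s)" using pos by (simp add: powr_add)
  also have "1 / (m powr (2 * s) * m) = m powr (- 1 - 2 * s)" using pos by (simp add: powr_diff powr_minus_divide mult.commute)
  finally have main: "(m / X) powr (- (real n + 2 * s)) / (\<tau> * X / (m * z)) ^ n * (\<tau>\<^sup>2 * X / (S * m * z\<^sup>2))
    = m powr (- 1 - 2 * s) * \<tau>\<^sup>2 / \<tau> ^ n * (z ^ j * X powr (1 + 2 * s) / S)"
    by (simp only: times_divide_eq_right times_divide_eq_left divide_divide_eq_left mult_ac)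
  have "H_integrand \<theta> = z ^ j * X powr (1 + 2 * s) / S"
    using j unfolding H_integrand_def S_def X_def z_def by (simp only: diff_add_inverse2)
  then show ?thesis
    unfolding sqrt_1_ray_cot[OF t th] ang_dist_ray_cot[OF t th] S_def[symmetric]
    unfolding X_def[symmetric] m_def[symmetric] z_def[symmetric] using main by (simp only:)
qed

text \<open>The prefactor of \<open>H\<close> consists of the power of
  \<open>\<tau>\<^sup>2 - 1\<close> left over by the substitution and of
  \<open>\<tau> ^ (n - 1) * \<tau>\<^sup>2 / \<tau> ^ n = \<tau>\<close>.\<close>

lemma ang_ker_eq_H_fun:
  "((n - 1) * unit_ball_vol (n - 1)) * \<tau> ^ (n - 1) * ang_ker n (n + 2 * s) 0 \<tau>
    = \<tau> * (\<tau>\<^sup>2 - 1) powr (- 1 - 2 * s) * H_fun s n \<tau>"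
proof -
  let ?f = "\<lambda>k. ang_dist \<tau> k powr (- (real n + 2 * s)) / sqrt (1 + k\<^sup>2) ^ n"
  let ?g' = "\<lambda>\<theta>. \<tau>\<^sup>2 * (sqrt (\<tau>\<^sup>2 - (sin \<theta>)\<^sup>2) + cos \<theta>) / (sqrt (\<tau>\<^sup>2 - (sin \<theta>)\<^sup>2) * (\<tau>\<^sup>2 - 1) * (sin \<theta>)\<^sup>2)"
  let ?K = "(\<tau>\<^sup>2 - 1) powr (- 1 - 2 * s) * \<tau>\<^sup>2 / \<tau> ^ n"
  have ad: "ang_dist \<tau> k > 0" for k using ang_dist_ge[of \<tau> k] t by linarith
  have rs: "sqrt (\<tau>\<^sup>2 - (sin \<theta>)\<^sup>2) > 0" "sqrt (\<tau>\<^sup>2 - (sin \<theta>)\<^sup>2) + cos \<theta> > 0" "\<tau>\<^sup>2 - 1 > 0" for \<theta>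
    using ray_sqrt(2,6)[OF t, of \<theta>] ray_sqrt(5)[OF t] by auto
  have contf: "isCont ?f k" for k
  proof -
    have "isCont (ang_dist \<tau>) k"
      unfolding ang_dist_def[abs_def] using sqrt_1_plus_sq_pos[of k] by (intro continuous_intros) auto
    then show ?thesis using ad[of k] sqrt_1_plus_sq_pos[of k] by (intro continuous_intros) auto
  qed
  have "set_integrable lborel {0..pi} (\<lambda>\<theta>. ?K * H_integrand \<theta>)"
    using set_integrable_H_integrand by (rule set_integrable_mult_right)
  then have "set_integrable lborel {0<..<pi} (\<lambda>\<theta>. ?K * H_integrand \<theta>)"
    by (rule set_integrable_subset) auto
  then have int: "set_integrable lborel (einterval (ereal 0) (ereal pi)) (\<lambda>\<theta>. ?f (ray_cot \<tau> \<theta>) * ?g' \<theta>)"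
    by (subst set_integrable_cong[OF refl refl ray_cot_substitution]) (auto simp: einterval_iff)
  have "(LBINT k=-\<infinity>..\<infinity>. ?f k) = (LBINT \<theta>=ereal 0..ereal pi. ?f (ray_cot \<tau> \<theta>) * ?g' \<theta>)"
  proof (rule interval_integral_substitution_nonneg(2)[OF _ _ contf _ _ _ _ _ int])
    show "DERIV (ray_cot \<tau>) \<theta> :> ?g' \<theta>" if "ereal 0 < ereal \<theta>" "ereal \<theta> < ereal pi" for \<theta>
      using that by (intro ray_cot_deriv[OF t]) auto
    show "isCont ?g' \<theta>" if "ereal 0 < ereal \<theta>" "ereal \<theta> < ereal pi" for \<theta>
      using that rs(1,2)[of \<theta>] rs(3) sin_gt_zero[of \<theta>] by (intro continuous_intros) auto
    show "0 \<le> ?g' \<theta>" for \<theta>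
      using rs(1,2)[of \<theta>] rs(3) by (intro divide_nonneg_nonneg mult_nonneg_nonneg) auto
    show "((ereal \<circ> ray_cot \<tau> \<circ> real_of_ereal) \<longlongrightarrow> - \<infinity>) (at_right (ereal 0))"
      using ray_cot_limits(1)[OF t] by (simp add: ereal_tendsto_simps)
    show "((ereal \<circ> ray_cot \<tau> \<circ> real_of_ereal) \<longlongrightarrow> \<infinity>) (at_left (ereal pi))"
      using ray_cot_limits(2)[OF t] by (simp add: ereal_tendsto_simps)
  qed auto
  also have "\<dots> = (LBINT \<theta>=ereal 0..ereal pi. ?K * H_integrand \<theta>)"
  proof (rule interval_integral_cong)
    fix \<theta> assume "\<theta> \<in> einterval (min (ereal 0) (ereal pi)) (max (ereal 0) (ereal pi))"
    then have "0 < \<theta>" "\<theta> < pi" by (auto simp: einterval_iff)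
    then show "?f (ray_cot \<tau> \<theta>) * ?g' \<theta> = ?K * H_integrand \<theta>" by (rule ray_cot_substitution)
  qed
  also have "\<dots> = ?K * integral {0..pi} H_integrand"
    using set_integrable_H_integrand by (simp add: interval_integral_eq_integral)
  finally have ak: "ang_ker n (n + 2 * s) 0 \<tau> = ?K * integral {0..pi} H_integrand"
    using ad by (simp add: ang_ker_def interval_lebesgue_integral_def set_lebesgue_integral_def)
  have "\<tau> ^ (n - 1) * \<tau>\<^sup>2 / \<tau> ^ n = \<tau>"
  proof -
    obtain j where j: "n = j + 2" using n by (metis le_add_diff_inverse2)
    show ?thesis using t by (simp add: j power2_eq_square)
  qed
  moreover have "a * \<tau> ^ (n - 1) * (M * \<tau>\<^sup>2 / \<tau> ^ n * I) = (\<tau> ^ (n - 1) * \<tau>\<^sup>2 / \<tau> ^ n) * M * (a * I)" for a M I :: real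
    by simp
  ultimately show ?thesis
    unfolding unit_ball_vol_eq_alpha_n[OF n] H_fun_eq ak by (simp only:)
qed

text \<open>With \<open>S\<close> the square root in the integrand,
  \<open>\<bar>cos \<theta>\<bar> < S\<close> bounds the power by that of \<open>2 * S\<close>,
  which absorbs the denominator \<open>S\<close>. This matters because \<open>S\<close> may be
  arbitrarily small as \<open>\<tau>\<close> tends to 1; the bound stays finite there.\<close>

lemma H_integral_le: "integral {0..pi} H_integrand \<le> pi * (2 powr (1 + 2 * s) * \<tau> powr (2 * s))"
proof -
  have "H_integrand \<theta> \<le> 2 powr (1 + 2 * s) * \<tau> powr (2 * s)" if "\<theta> \<in> {0..pi}" for \<theta>
  proof -
    define S where "S = sqrt (\<tau>\<^sup>2 - (sin \<theta>)\<^sup>2)"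
    have S: "S > 0" "S + cos \<theta> > 0" "S \<le> \<tau>" "\<bar>cos \<theta>\<bar> < S"
      using ray_sqrt(2,3,4,6)[OF t, of \<theta>] by (auto simp: S_def)
    have "sin \<theta> ^ (n - 2) \<le> 1" using that by (intro power_le_one sin_ge_zero) auto
    moreover have "(S + cos \<theta>) powr (1 + 2 * s) \<le> (2 * S) powr (1 + 2 * s)"
      using S s by (intro powr_mono2) auto
    moreover have "(2 * S) powr (1 + 2 * s) / S = 2 powr (1 + 2 * s) * S powr (2 * s)"
      using S by (simp add: powr_mult powr_add)
    moreover have "S powr (2 * s) \<le> \<tau> powr (2 * s)" using S s by (intro powr_mono2) auto
    moreover have "(S + cos \<theta>) powr (1 + 2 * s) / S \<le> (2 * S) powr (1 + 2 * s) / S"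
      using calculation(2) S by (intro divide_right_mono) auto
    moreover have "2 powr (1 + 2 * s) * S powr (2 * s) \<le> 2 powr (1 + 2 * s) * \<tau> powr (2 * s)"
      using calculation(4) by (intro mult_left_mono) auto
    ultimately have "(S + cos \<theta>) powr (1 + 2 * s) / S \<le> 2 powr (1 + 2 * s) * \<tau> powr (2 * s)"
      by linarith
    with \<open>sin \<theta> ^ (n - 2) \<le> 1\<close>
    have "sin \<theta> ^ (n - 2) * ((S + cos \<theta>) powr (1 + 2 * s) / S) \<le> 1 * (2 powr (1 + 2 * s) * \<tau> powr (2 * s))"
      using S by (intro mult_mono) auto
    then show ?thesis by (simp add: H_integrand_def S_def)
  qed
  then have "integral {0..pi} H_integrand \<le> integral {0..pi} (\<lambda>_. 2 powr (1 + 2 * s) * \<tau> powr (2 * s))"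
    by (intro integral_le integrable_continuous_interval continuous_on_H_integrand) auto
  then show ?thesis by (simp add: mult_ac)
qed

end

section \<open>Size of the kernel and Taylor expansion\<close>

text \<open>Going through \<open>H\<close> yields the exponent -1-2s at \<open>\<tau> = 1\<close>,
  whereas \<open>ang_ker_le\<close> with \<open>m = \<bar>\<tau> - 1\<bar>\<close> would give only
  -n-2s.\<close>

lemma ang_ker_0_le:
  assumes s: "0 < s" and n: "n \<ge> 2" and t: "\<tau> > 1"
  shows "\<tau> ^ (n - 1) * ang_ker n (n + 2 * s) 0 \<tau>
    \<le> pi * 2 powr (1 + 2 * s) * (\<tau> * (\<tau>\<^sup>2 - 1) powr (- 1 - 2 * s) * \<tau> powr (2 * s))"
proof -
  define c where "c = real (n - 1) * unit_ball_vol (real (n - 1))"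
  have c: "c > 0" using n by (simp add: c_def)
  let ?I = "integral {0..pi} (H_integrand s \<tau> n)"
  have "H_fun s n \<tau> = c * ?I"
    unfolding c_def unit_ball_vol_eq_alpha_n[OF n] by (rule H_fun_eq[OF s n t])
  with ang_ker_eq_H_fun[OF s n t]
  have "c * (\<tau> ^ (n - 1) * ang_ker n (n + 2 * s) 0 \<tau>) = c * (\<tau> * (\<tau>\<^sup>2 - 1) powr (- 1 - 2 * s) * ?I)"
    unfolding c_def by (simp only: mult_ac)
  then have "\<tau> ^ (n - 1) * ang_ker n (n + 2 * s) 0 \<tau> = \<tau> * (\<tau>\<^sup>2 - 1) powr (- 1 - 2 * s) * ?I"
    using c by simp
  also have "\<dots> \<le> \<tau> * (\<tau>\<^sup>2 - 1) powr (- 1 - 2 * s) * (pi * (2 powr (1 + 2 * s) * \<tau> powr (2 * s)))"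
    using t H_integral_le[OF s n t] by (intro mult_left_mono) auto
  finally show ?thesis by (simp add: mult_ac)
qed

lemma ang_ker_0_near:
  assumes s: "0 < s" and n: "n \<ge> 2"
  obtains C where "C \<ge> 0"
    "\<And>\<tau>. 1 < \<tau> \<Longrightarrow> \<tau> \<le> 2 \<Longrightarrow> \<tau> ^ (n - 1) * ang_ker n (n + 2 * s) 0 \<tau> \<le> C * (\<tau> - 1) powr (- 1 - 2 * s)"
proof
  have e: "- 1 - 2 * s = - (1 + 2 * s)" by simp
  define D where "D = pi * 2 powr (1 + 2 * s)"
  show "D * (2 * 2 powr (2 * s)) \<ge> 0" by (simp add: D_def)
  fix \<tau> :: real assume t: "1 < \<tau>" "\<tau> \<le> 2"
  have "\<tau> - 1 \<le> (\<tau> - 1) * (\<tau> + 1)" using t mult_left_mono[of 1 "\<tau> + 1" "\<tau> - 1"] by simp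
  then have "\<tau> - 1 \<le> \<tau>\<^sup>2 - 1" by (simp add: algebra_simps power2_eq_square)
  then have 1: "(\<tau>\<^sup>2 - 1) powr (- (1 + 2 * s)) \<le> (\<tau> - 1) powr (- (1 + 2 * s))"
    using t s by (intro powr_mono2') auto
  have 2: "\<tau> powr (2 * s) \<le> 2 powr (2 * s)" using t s by (intro powr_mono2) auto
  have "\<tau> * (\<tau>\<^sup>2 - 1) powr (- (1 + 2 * s)) * \<tau> powr (2 * s) \<le> 2 * (\<tau> - 1) powr (- (1 + 2 * s)) * 2 powr (2 * s)"
    using 1 2 t by (intro mult_mono) auto
  then have "D * (\<tau> * (\<tau>\<^sup>2 - 1) powr (- (1 + 2 * s)) * \<tau> powr (2 * s)) \<le> D * (2 * (\<tau> - 1) powr (- (1 + 2 * s)) * 2 powr (2 * s))"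
    by (intro mult_left_mono) (auto simp: D_def)
  also have "\<dots> = D * (2 * 2 powr (2 * s)) * (\<tau> - 1) powr (- (1 + 2 * s))"
    by (simp only: mult_ac)
  finally show "\<tau> ^ (n - 1) * ang_ker n (n + 2 * s) 0 \<tau> \<le> D * (2 * 2 powr (2 * s)) * (\<tau> - 1) powr (- 1 - 2 * s)"
    using ang_ker_0_le[OF s n t(1)] unfolding D_def e by linarith
qed

text \<open>For \<open>\<tau> \<ge> 2\<close> the factor \<open>\<tau>\<^sup>2 - 1\<close> is
  comparable to \<open>\<tau>\<^sup>2\<close>, and 1 - (2 + 4s) + 2s = -1-2s. This is the decay of
  the weight r^(n-1) / (1+r)^(n+2s) in the growth hypothesis.\<close>

lemma ang_ker_0_far:
  assumes s: "0 < s" and n: "n \<ge> 2"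
  obtains C where "C \<ge> 0"
    "\<And>\<tau>. \<tau> \<ge> 2 \<Longrightarrow> \<tau> ^ (n - 1) * ang_ker n (n + 2 * s) 0 \<tau> \<le> C * \<tau> powr (- 1 - 2 * s)"
proof
  have e: "- 1 - 2 * s = - (1 + 2 * s)" by simp
  define D where "D = pi * 2 powr (1 + 2 * s)"
  show "D * 2 powr (1 + 2 * s) \<ge> 0" by (simp add: D_def)
  fix \<tau> :: real assume t: "\<tau> \<ge> 2"
  have "2 * 2 \<le> \<tau> * \<tau>" using t by (intro mult_mono) auto
  then have "\<tau>\<^sup>2 / 2 \<le> \<tau>\<^sup>2 - 1" by (simp add: power2_eq_square)
  then have "(\<tau>\<^sup>2 - 1) powr (- (1 + 2 * s)) \<le> (\<tau>\<^sup>2 / 2) powr (- (1 + 2 * s))"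
    using t s by (intro powr_mono2') auto
  also have "\<dots> = 2 powr (1 + 2 * s) * (\<tau>\<^sup>2) powr (- (1 + 2 * s))"
  proof -
    have "(y / 2) powr (- p) = 2 powr p * y powr (- p)" if "y > 0" for y p :: real
      using that by (simp add: powr_divide powr_minus_divide)
    moreover have "\<tau>\<^sup>2 > 0" using t by simp
    ultimately show ?thesis .
  qed
  also have "(\<tau>\<^sup>2) powr (- (1 + 2 * s)) = \<tau> powr (- 2 - 4 * s)"
  proof -
    have "\<tau>\<^sup>2 = \<tau> powr 2" using t by simp
    then show ?thesis unfolding powr_powr by (simp only: powr_powr) simp
  qed
  finally have "\<tau> * (\<tau>\<^sup>2 - 1) powr (- (1 + 2 * s)) * \<tau> powr (2 * s)
      \<le> \<tau> * (2 powr (1 + 2 * s) * \<tau> powr (- 2 - 4 * s)) * \<tau> powr (2 * s)"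
    using t by (intro mult_right_mono mult_left_mono) auto
  also have "\<dots> = 2 powr (1 + 2 * s) * (\<tau> powr 1 * \<tau> powr (- 2 - 4 * s) * \<tau> powr (2 * s))"
    using t by simp
  also have "\<tau> powr 1 * \<tau> powr (- 2 - 4 * s) * \<tau> powr (2 * s) = \<tau> powr (- 1 - 2 * s)"
    unfolding powr_add[symmetric] by (rule arg_cong[where f="\<lambda>p. \<tau> powr p"]) simp
  finally have "D * (\<tau> * (\<tau>\<^sup>2 - 1) powr (- (1 + 2 * s)) * \<tau> powr (2 * s)) \<le> D * (2 powr (1 + 2 * s) * \<tau> powr (- 1 - 2 * s))"
    by (intro mult_left_mono) (auto simp: D_def)
  also have "\<dots> = D * 2 powr (1 + 2 * s) * \<tau> powr (- 1 - 2 * s)"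
    by (simp only: mult_ac)
  finally have "D * (\<tau> * (\<tau>\<^sup>2 - 1) powr (- (1 + 2 * s)) * \<tau> powr (2 * s)) \<le> D * 2 powr (1 + 2 * s) * \<tau> powr (- 1 - 2 * s)" .
  moreover have "1 < \<tau>" using t by simp
  ultimately show "\<tau> ^ (n - 1) * ang_ker n (n + 2 * s) 0 \<tau> \<le> D * 2 powr (1 + 2 * s) * \<tau> powr (- 1 - 2 * s)"
    using ang_ker_0_le[OF s n, of \<tau>] unfolding D_def e by linarith
qed

text \<open>The constant may depend on \<open>\<delta>\<close>: this bound serves the integrability
  of a fixed truncation, while uniformity in \<open>\<delta>\<close> comes from
  monotonicity.\<close>

lemma ang_ker_far:
  assumes s: "0 < s" and n: "n \<ge> 2" and d: "\<delta> > 0"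
  obtains C where "C \<ge> 0"
    "\<And>\<tau>. \<tau> \<ge> 1 \<Longrightarrow> \<tau> ^ (n - 1) * ang_ker n (n + 2 * s) \<delta> \<tau> \<le> C * \<tau> powr (- 1 - 2 * s)"
proof -
  obtain C where C: "C \<ge> 0" "\<And>\<tau>. \<tau> \<ge> 2 \<Longrightarrow> \<tau> ^ (n - 1) * ang_ker n (n + 2 * s) 0 \<tau> \<le> C * \<tau> powr (- 1 - 2 * s)"
    using ang_ker_0_far[OF s n] by blast
  define D where "D = \<delta> powr (- (n + 2 * s)) * (\<integral>k. 1 / (1 + k\<^sup>2) \<partial>lborel)"
  have D: "ang_ker n (n + 2 * s) \<delta> \<tau> \<le> D" for \<tau>
    unfolding D_def using n s d by (intro ang_ker_le) auto
  then have D0: "D \<ge> 0" using ang_ker_nonneg order_trans by blast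
  \<comment> \<open>Chosen so that \<open>E * 2 powr (- 1 - 2 * s)\<close> is the crude bound
    \<open>2 ^ (n - 1) * D\<close> valid between 1 and 2.\<close>
  define E where "E = 2 ^ (n - 1) * D * 2 powr (1 + 2 * s)"
  have E: "E \<ge> 0" using D0 by (simp add: E_def)
  show ?thesis
  proof (rule that[of "C + E"])
    fix \<tau> :: real assume t: "\<tau> \<ge> 1"
    show "\<tau> ^ (n - 1) * ang_ker n (n + 2 * s) \<delta> \<tau> \<le> (C + E) * \<tau> powr (- 1 - 2 * s)"
    proof (cases "\<tau> \<ge> 2")
      case True
      have "\<tau> ^ (n - 1) * ang_ker n (n + 2 * s) \<delta> \<tau> \<le> \<tau> ^ (n - 1) * ang_ker n (n + 2 * s) 0 \<tau>"
        using True n s d by (intro mult_left_mono ang_ker_antimono) auto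
      also have "\<dots> \<le> C * \<tau> powr (- 1 - 2 * s)" using C(2) True by blast
      also have "\<dots> \<le> (C + E) * \<tau> powr (- 1 - 2 * s)" using E by (intro mult_right_mono) auto
      finally show ?thesis .
    next
      case False
      have "\<tau> ^ (n - 1) * ang_ker n (n + 2 * s) \<delta> \<tau> \<le> 2 ^ (n - 1) * D"
        using False t D D0 ang_ker_nonneg by (intro mult_mono power_mono) auto
      also have "\<dots> = E * 2 powr (- 1 - 2 * s)"
      proof -
        have "2 powr (1 + 2 * s) * 2 powr (- 1 - 2 * s) = 1" unfolding powr_add[symmetric] by simp
        then show ?thesis unfolding E_def mult.assoc by simp
      qed
      also have "\<dots> \<le> E * \<tau> powr (- 1 - 2 * s)"
      proof -
        have "2 powr (- (1 + 2 * s)) \<le> \<tau> powr (- (1 + 2 * s))"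
          using False t s by (intro powr_mono2') auto
        then have "2 powr (- 1 - 2 * s) \<le> \<tau> powr (- 1 - 2 * s)" by simp
        then show ?thesis using E by (rule mult_left_mono)
      qed
      also have "\<dots> \<le> (C + E) * \<tau> powr (- 1 - 2 * s)" using C by (intro mult_right_mono) auto
      finally show ?thesis .
    qed
  qed (use C E in auto)
qed

section \<open>Integrable majorants and the radial Taylor expansion\<close>

lemma set_integrable_powr_to_inf:
  fixes s :: real
  assumes "s > 0"
  shows "set_integrable lborel {1<..} (\<lambda>\<tau>::real. \<tau> powr (- 1 - 2 * s))"
proof -
  have "(\<lambda>x. x powr (- 1 - 2 * s)) integrable_on {1..}"
    using has_integral_powr_to_inf[of "- 1 - 2 * s" 1] assms by (auto simp: integrable_on_def)
  then have "(\<lambda>x::real. x powr (- 1 - 2 * s)) absolutely_integrable_on {1..}"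
    by (rule nonnegative_absolutely_integrable_1) auto
  then have "set_integrable lborel {1..} (\<lambda>\<tau>::real. \<tau> powr (- 1 - 2 * s))"
    unfolding set_integrable_def by (subst (asm) integrable_completion) auto
  then show ?thesis by (rule set_integrable_subset) auto
qed

lemma set_integrable_powr_near_1:
  fixes s :: real
  assumes "s < 1"
  shows "set_integrable lborel {1<..2} (\<lambda>\<tau>::real. (\<tau> - 1) powr (1 - 2 * s))"
proof -
  have "(\<lambda>x::real. x powr (1 - 2 * s)) integrable_on {0..1}"
    using assms by (intro integrable_on_powr_from_0) auto
  then have "(\<lambda>x::real. x powr (1 - 2 * s)) absolutely_integrable_on {0..1}"
    by (rule nonnegative_absolutely_integrable_1) auto
  then have "integrable lborel (\<lambda>x::real. indicator {0..1} x * x powr (1 - 2 * s))"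
    unfolding set_integrable_def by (subst (asm) integrable_completion) auto
  from lborel_integrable_real_affine[OF this, of 1 "-1"]
  have "integrable lborel (\<lambda>x::real. indicator {0..1} (x - 1) * (x - 1) powr (1 - 2 * s))" by simp
  also have "(\<lambda>x::real. indicator {0..1} (x - 1) * (x - 1) powr (1 - 2 * s))
     = (\<lambda>x. indicator {1..2} x * (x - 1) powr (1 - 2 * s))" by (auto simp: indicator_def)
  finally have "set_integrable lborel {1..2} (\<lambda>\<tau>::real. (\<tau> - 1) powr (1 - 2 * s))"
    by (simp add: set_integrable_def)
  then show ?thesis by (rule set_integrable_subset) auto
qed

text \<open>Restricted to a line through the origin, the radial function becomes
  \<open>u \<bar>t\<bar>\<close>, which is twice continuously differentiable also at 0, so Taylor's
  formula holds up to \<open>\<rho> = 0\<close>. The range up to \<open>2 * r\<close> contains both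
  \<open>r * \<tau>\<close> and \<open>r / \<tau>\<close> for \<open>\<tau>\<close> between 1 and
  2.\<close>

lemma C2_radial_expansion:
  fixes u :: "real \<Rightarrow> real"
  assumes C2: "C2_on_UNIV (\<lambda>y::real^'n. u (norm y))" and r: "r > 0"
  obtains C a where "C \<ge> 0" "\<And>\<rho>. 0 \<le> \<rho> \<Longrightarrow> \<rho> \<le> 2 * r \<Longrightarrow> \<bar>u \<rho> - u r - a * (\<rho> - r)\<bar> \<le> C * (\<rho> - r)\<^sup>2"
    and "continuous_on UNIV (\<lambda>t. u \<bar>t\<bar>)"
proof -
  obtain f' :: "real^'n \<Rightarrow> (real^'n) \<Rightarrow>\<^sub>L real" and f'' :: "real^'n \<Rightarrow> (real^'n) \<Rightarrow>\<^sub>L ((real^'n) \<Rightarrow>\<^sub>L real)"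
    where f': "\<And>x. ((\<lambda>y::real^'n. u (norm y)) has_derivative blinfun_apply (f' x)) (at x)"
    and f'': "\<And>x. (f' has_derivative blinfun_apply (f'' x)) (at x)"
    and cont: "continuous_on UNIV f''"
    using C2 unfolding C2_on_UNIV_def by blast
  obtain b :: "real^'n" where "b \<in> Basis" by (meson nonempty_Basis ex_in_conv)
  then have b: "norm b = 1" by simp
  define \<phi> where "\<phi> t = u \<bar>t\<bar>" for t
  define \<phi>1 where "\<phi>1 t = blinfun_apply (f' (t *\<^sub>R b)) b" for t
  define \<phi>2 where "\<phi>2 t = blinfun_apply (blinfun_apply (f'' (t *\<^sub>R b)) b) b" for t
  have \<phi>: "\<phi> = (\<lambda>t. u (norm (t *\<^sub>R b)))" by (auto simp: \<phi>_def b)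
  have l: "((\<lambda>t. t *\<^sub>R b) has_derivative (\<lambda>h. h *\<^sub>R b)) (at t)" for t
    by (auto intro!: derivative_eq_intros)
  have d1: "DERIV \<phi> t :> \<phi>1 t" for t
  proof -
    have "(\<phi> has_derivative (\<lambda>h. blinfun_apply (f' (t *\<^sub>R b)) (h *\<^sub>R b))) (at t)"
      unfolding \<phi> by (rule has_derivative_compose[OF l f'])
    moreover have "(\<lambda>h. blinfun_apply (f' (t *\<^sub>R b)) (h *\<^sub>R b)) = (*) (\<phi>1 t)"
      by (rule ext) (simp add: \<phi>1_def blinfun.scaleR_right)
    ultimately show ?thesis by (simp only: has_field_derivative_def)
  qed
  have d2: "DERIV \<phi>1 t :> \<phi>2 t" for t
  proof -
    have "((\<lambda>t. f' (t *\<^sub>R b)) has_derivative (\<lambda>h. blinfun_apply (f'' (t *\<^sub>R b)) (h *\<^sub>R b))) (at t)"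
      by (rule has_derivative_compose[OF l f''])
    from bounded_linear.has_derivative[OF blinfun.bounded_linear_left[of b] this]
    have "(\<phi>1 has_derivative (\<lambda>h. blinfun_apply (blinfun_apply (f'' (t *\<^sub>R b)) (h *\<^sub>R b)) b)) (at t)"
      unfolding \<phi>1_def[abs_def] .
    moreover have "(\<lambda>h. blinfun_apply (blinfun_apply (f'' (t *\<^sub>R b)) (h *\<^sub>R b)) b) = (*) (\<phi>2 t)"
      by (rule ext) (simp add: \<phi>2_def blinfun.scaleR_right blinfun.scaleR_left)
    ultimately show ?thesis by (simp only: has_field_derivative_def)
  qed
  have "continuous_on UNIV (\<lambda>t. f'' (t *\<^sub>R b))"
    by (rule continuous_on_compose2[OF cont]) (auto intro!: continuous_intros)
  then have "continuous_on UNIV \<phi>2"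
    unfolding \<phi>2_def[abs_def] by (intro continuous_intros) auto
  then have "compact (\<phi>2 ` {0..2 * r})"
    by (intro compact_continuous_image) (auto intro: continuous_on_subset)
  then have "bounded (\<phi>2 ` {0..2 * r})" by (rule compact_imp_bounded)
  then obtain M where "\<forall>x\<in>\<phi>2 ` {0..2 * r}. \<bar>x\<bar> \<le> M"
    unfolding bounded_real by blast
  then have M: "\<And>t. t \<in> {0..2 * r} \<Longrightarrow> \<bar>\<phi>2 t\<bar> \<le> M" by blast
  have M0: "M \<ge> 0" using M[of r] r by auto
  show ?thesis
  proof (rule that[of M "\<phi>1 r"])
    show "M \<ge> 0" by fact
    show "continuous_on UNIV (\<lambda>t. u \<bar>t\<bar>)"
      using DERIV_continuous_on[of UNIV \<phi> \<phi>1] d1 unfolding \<phi>_def[abs_def] by blast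
    fix \<rho> assume \<rho>: "0 \<le> \<rho>" "\<rho> \<le> 2 * r"
    show "\<bar>u \<rho> - u r - \<phi>1 r * (\<rho> - r)\<bar> \<le> M * (\<rho> - r)\<^sup>2"
    proof (cases "\<rho> = r")
      case False
      define diff where "diff m = (if m = 0 then \<phi> else if m = 1 then \<phi>1 else \<phi>2)" for m :: nat
      have "\<exists>t. (if \<rho> < r then \<rho> < t \<and> t < r else r < t \<and> t < \<rho>) \<and>
         \<phi> \<rho> = (\<Sum>m<2. diff m r / fact m * (\<rho> - r) ^ m) + diff 2 t / fact 2 * (\<rho> - r) ^ 2"
        by (rule Taylor[where a=0 and b="2 * r"])
           (use \<rho> r False d1 d2 in \<open>auto simp: diff_def less_2_cases_iff\<close>)
      then obtain t where t: "if \<rho> < r then \<rho> < t \<and> t < r else r < t \<and> t < \<rho>"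
        and eq: "\<phi> \<rho> = (\<Sum>m<2. diff m r / fact m * (\<rho> - r) ^ m) + diff 2 t / fact 2 * (\<rho> - r) ^ 2" by blast
      have "u \<rho> - u r - \<phi>1 r * (\<rho> - r) = \<phi>2 t / 2 * (\<rho> - r)\<^sup>2"
        using eq \<rho> r by (simp add: diff_def \<phi>_def numeral_2_eq_2)
      moreover have "\<bar>\<phi>2 t / 2\<bar> \<le> M" using M[of t] t \<rho> r M0 by (auto split: if_splits)
      then have "\<bar>\<phi>2 t / 2\<bar> * (\<rho> - r)\<^sup>2 \<le> M * (\<rho> - r)\<^sup>2" by (rule mult_right_mono) simp
      ultimately show ?thesis by (simp only: abs_mult abs_power2)
    qed simp
  qed
qed

section \<open>Inversion of the radius and the shell estimate\<close>

lemma set_integrable_bound_powr: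
  fixes f :: "real \<Rightarrow> real"
  assumes g: "set_integrable lborel A g" and [measurable]: "f \<in> borel_measurable borel" "A \<in> sets borel"
    and le: "\<And>\<tau>. \<tau> \<in> A \<Longrightarrow> \<bar>f \<tau>\<bar> \<le> g \<tau>"
  shows "set_integrable lborel A f"
  unfolding set_integrable_def
  by (rule Bochner_Integration.integrable_bound[OF g[unfolded set_integrable_def]])
     (use le in \<open>auto intro!: AE_I2 simp: indicator_def intro: order_trans[OF _ abs_ge_self]\<close>)

text \<open>Integrability is assumed on the folded side, where the kernel bounds are available, and
  is derived on the unit interval. The detour through \<open>lebesgue\<close> is made for the change
  of variables for absolutely integrable functions.\<close>

lemma set_integral_fold_inverse:
  fixes f :: "real \<Rightarrow> real"
  assumes [measurable]: "f \<in> borel_measurable borel"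
    and g: "set_integrable lborel {1<..} (\<lambda>\<tau>. f (1 / \<tau>) / \<tau>\<^sup>2)"
  shows "set_integrable lborel {0<..<1} f"
    "(LBINT \<tau>:{0<..<1}. f \<tau>) = (LBINT \<tau>:{1<..}. f (1 / \<tau>) / \<tau>\<^sup>2)"
proof -
  let ?h = "\<lambda>\<tau>. \<bar>- (1 / \<tau>\<^sup>2)\<bar> * f (1 / \<tau>)"
  have im: "(\<lambda>\<tau>::real. 1 / \<tau>) ` {1<..} = {0<..<1}"
  proof safe
    fix x :: real assume "x \<in> {0<..<1}"
    then show "x \<in> (\<lambda>\<tau>. 1 / \<tau>) ` {1<..}" by (intro image_eqI[of _ _ "1 / x"]) auto
  qed auto
  have g': "set_integrable lborel {1<..} ?h" using g by (simp add: mult.commute)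
  then have "integrable lebesgue (\<lambda>\<tau>. indicator {1<..} \<tau> *\<^sub>R ?h \<tau>)"
    unfolding set_integrable_def by (subst integrable_completion) auto
  then have ai: "?h absolutely_integrable_on {1<..}" by (simp add: set_integrable_def)
  have "f absolutely_integrable_on (\<lambda>\<tau>. 1 / \<tau>) ` {1<..} \<and>
     integral ((\<lambda>\<tau>. 1 / \<tau>) ` {1<..}) f = integral {1<..} ?h"
    by (rule has_absolute_integral_change_of_variables_1'[THEN iffD1])
       (use ai in \<open>auto intro!: derivative_eq_intros inj_onI simp: power2_eq_square\<close>)
  then have f: "f absolutely_integrable_on {0<..<1}" "integral {0<..<1} f = integral {1<..} ?h"
    unfolding im by auto
  then show f': "set_integrable lborel {0<..<1} f"
    unfolding set_integrable_def by (subst (asm) integrable_completion) auto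
  have "(LBINT \<tau>:{0<..<1}. f \<tau>) = integral {0<..<1} f" by (rule set_borel_integral_eq_integral(2)[OF f'])
  also have "\<dots> = (LBINT \<tau>:{1<..}. ?h \<tau>)"
    unfolding f(2) by (rule set_borel_integral_eq_integral(2)[OF g', symmetric])
  finally show "(LBINT \<tau>:{0<..<1}. f \<tau>) = (LBINT \<tau>:{1<..}. f (1 / \<tau>) / \<tau>\<^sup>2)" by (simp add: mult.commute)
qed

lemma ang_ker_antimono_pos:
  assumes "n \<ge> 2" "N \<ge> 0" "0 < \<delta>" "\<delta> \<le> \<delta>'"
  shows "ang_ker n N \<delta>' \<tau> \<le> ang_ker n N \<delta> \<tau>"
  unfolding ang_ker_def
  by (rule integral_mono; (rule integrable_ang_ker[where m=\<delta>])?)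
     (use assms in \<open>auto simp: indicator_def\<close>)

lemma set_integrable_ang_ker:
  fixes s :: real
  assumes s: "0 < s" and n: "n \<ge> 2" and d: "\<delta> > 0"
  shows "set_integrable lborel {0<..} (\<lambda>\<tau>. \<tau> ^ (n - 1) * ang_ker n (n + 2 * s) \<delta> \<tau>)"
proof -
  have [measurable]: "(\<lambda>\<tau>. ang_ker n (n + 2 * s) \<delta> \<tau>) \<in> borel_measurable borel"
    by (rule ang_ker_measurable) simp
  obtain C where C: "C \<ge> 0" "\<And>\<tau>. \<tau> \<ge> 1 \<Longrightarrow> \<tau> ^ (n - 1) * ang_ker n (n + 2 * s) \<delta> \<tau> \<le> C * \<tau> powr (- 1 - 2 * s)"
    using ang_ker_far[OF s n d] by blast
  define D where "D = \<delta> powr (- (n + 2 * s)) * (\<integral>k. 1 / (1 + k\<^sup>2) \<partial>lborel)"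
  have D: "ang_ker n (n + 2 * s) \<delta> \<tau> \<le> D" for \<tau>
    unfolding D_def using n s d by (intro ang_ker_le) auto
  have "set_integrable lborel {1<..} (\<lambda>\<tau>. \<tau> ^ (n - 1) * ang_ker n (n + 2 * s) \<delta> \<tau>)"
    by (rule set_integrable_bound_powr[OF set_integrable_mult_right[OF set_integrable_powr_to_inf[OF s], of C]])
       (use C ang_ker_nonneg in auto)
  moreover have "set_integrable lborel {0<..1::real} (\<lambda>_. D)"
    by (auto simp: set_integrable_def intro!: integrable_real_indicator)
  then have "set_integrable lborel {0<..1} (\<lambda>\<tau>. \<tau> ^ (n - 1) * ang_ker n (n + 2 * s) \<delta> \<tau>)"
  proof (rule set_integrable_bound_powr)
    fix \<tau> :: real assume "\<tau> \<in> {0<..1}"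
    then have "\<tau> ^ (n - 1) * ang_ker n (n + 2 * s) \<delta> \<tau> \<le> 1 * D"
      using D ang_ker_nonneg by (intro mult_mono power_le_one) auto
    then show "\<bar>\<tau> ^ (n - 1) * ang_ker n (n + 2 * s) \<delta> \<tau>\<bar> \<le> D"
      using \<open>\<tau> \<in> {0<..1}\<close> ang_ker_nonneg[of n "n + 2 * s" \<delta> \<tau>] by simp
  qed auto
  ultimately have "set_integrable lborel ({1<..} \<union> {0<..1}) (\<lambda>\<tau>. \<tau> ^ (n - 1) * ang_ker n (n + 2 * s) \<delta> \<tau>)"
    by (rule set_integrable_Un) auto
  also have "{1<..} \<union> {0<..1} = {0::real<..}" by auto
  finally show ?thesis .
qed

text \<open>The polar formula with the constant radial function 1, read backwards: the left side is
  the integral of the kernel over the points at distance between \<open>\<delta>\<close> and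
  \<open>\<delta>'\<close> from a unit vector. There the kernel is at most its value at distance
  \<open>\<delta>\<close>.\<close>

lemma ang_ker_shell:
  fixes s :: real
  assumes s: "0 < s" and n: "CARD('n::finite) \<ge> 2" and d: "0 < \<delta>" "\<delta> \<le> \<delta>'"
  defines "c \<equiv> real (CARD('n) - 1) * unit_ball_vol (real (CARD('n) - 1))"
  shows "c * (LBINT \<tau>:{0<..}. \<tau> ^ (CARD('n) - 1) * (ang_ker CARD('n) (CARD('n) + 2 * s) \<delta> \<tau> - ang_ker CARD('n) (CARD('n) + 2 * s) \<delta>' \<tau>))
     \<le> \<delta> powr (- (CARD('n) + 2 * s)) * (unit_ball_vol CARD('n) * (\<delta>' ^ CARD('n) - \<delta> ^ CARD('n)))"
proof -
  define n where "n = CARD('n)"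
  have n2: "n \<ge> 2" using n by (simp add: n_def)
  define N where "N = n + 2 * s"
  have N: "N \<ge> 0" using s by (simp add: N_def)
  \<comment> \<open>A centre of norm 1 makes the scaling factor \<open>r ^ n * r powr (- N)\<close>
    equal to 1.\<close>
  obtain x :: "real^'n" where "x \<in> Basis" by (meson nonempty_Basis ex_in_conv)
  then have x: "norm x = 1" "x \<noteq> 0" by auto
  have int: "integrable lborel (\<lambda>\<tau>. 1 * (indicator {0<..} \<tau> * \<tau> ^ (n - 1) * ang_ker n N d \<tau>))" if "d > 0" for d
    using set_integrable_ang_ker[OF s n2 that] by (simp add: set_integrable_def N_def mult_ac)
  have A: "integrable lborel (\<lambda>y. dist x y powr (- N) * indicator {d<..} (dist x y))" 
    and B: "(\<integral>y. dist x y powr (- N) * indicator {d<..} (dist x y) \<partial>lborel)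
      = c * (LBINT \<tau>:{0<..}. \<tau> ^ (n - 1) * ang_ker n N d \<tau>)"  if "d > 0" for d
    using integrable_radial_ang_ker[OF n N x(2) that, of "\<lambda>_. 1"]
      integral_radial_ang_ker[OF n N x(2) that, of "\<lambda>_. 1"] int[OF that]
    by (simp_all add: x n_def[symmetric] c_def set_lebesgue_integral_def mult_ac)
  have d': "\<delta>' > 0" using d by simp
  have si: "set_integrable lborel {0<..} (\<lambda>\<tau>. \<tau> ^ (n - 1) * ang_ker n N d \<tau>)" if "d > 0" for d
    using set_integrable_ang_ker[OF s n2 that] by (simp add: N_def)
  let ?S = "cball x \<delta>' - cball x \<delta>"
  have "emeasure lborel ?S \<le> emeasure lborel (cball x \<delta>')" by (rule emeasure_mono) auto
  then have fin: "emeasure lborel ?S < \<infinity>" by (rule le_less_trans) (rule emeasure_lborel_cball_finite)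
  have "c * (LBINT \<tau>:{0<..}. \<tau> ^ (n - 1) * (ang_ker n N \<delta> \<tau> - ang_ker n N \<delta>' \<tau>))
    = c * (LBINT \<tau>:{0<..}. \<tau> ^ (n - 1) * ang_ker n N \<delta> \<tau>) - c * (LBINT \<tau>:{0<..}. \<tau> ^ (n - 1) * ang_ker n N \<delta>' \<tau>)"
    using set_integral_diff(2)[OF si[OF d(1)] si[OF d']] by (simp add: right_diff_distrib)
  also have "\<dots> = (\<integral>y. dist x y powr (- N) * indicator {\<delta><..} (dist x y) - dist x y powr (- N) * indicator {\<delta>'<..} (dist x y) \<partial>lborel)"
    unfolding B[OF d(1), symmetric] B[OF d', symmetric]
    by (rule Bochner_Integration.integral_diff[symmetric]) (rule A; use d d' in simp)+
  also have "\<dots> \<le> (\<integral>y. \<delta> powr (- N) * indicator ?S y \<partial>lborel)"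
  proof (rule integral_mono)
    show "integrable lborel (\<lambda>y. dist x y powr (- N) * indicator {\<delta><..} (dist x y) - dist x y powr (- N) * indicator {\<delta>'<..} (dist x y))"
      by (rule Bochner_Integration.integrable_diff) (rule A; use d d' in simp)+
    show "integrable lborel (\<lambda>y. \<delta> powr (- N) * indicator ?S y)"
      using fin by (intro integrable_mult_right integrable_real_indicator) auto
    fix y
    show "dist x y powr (- N) * indicator {\<delta><..} (dist x y) - dist x y powr (- N) * indicator {\<delta>'<..} (dist x y)
      \<le> \<delta> powr (- N) * indicator ?S y"
      using d N powr_mono2'[of "- N" \<delta> "dist x y"] by (auto simp: indicator_def)
  qed
  also have "\<dots> = \<delta> powr (- N) * measure lborel ?S" by simp
  also have "measure lborel ?S = measure lborel (cball x \<delta>') - measure lborel (cball x \<delta>)"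
    using d emeasure_lborel_cball_finite[of x \<delta>'] by (intro measure_Diff) auto
  also have "\<dots> = unit_ball_vol n * (\<delta>' ^ n - \<delta> ^ n)"
    using d d' by (simp add: content_cball n_def right_diff_distrib)
  finally show ?thesis by (simp add: n_def N_def)
qed

section \<open>The principal value in one dimension\<close>

text \<open>\<open>g\<close> stands for the increment \<open>u r - u (r * \<tau>)\<close> as a
  function of \<open>\<tau>\<close>; the expansion forces \<open>g 1 = 0\<close>.\<close>

context
  fixes g :: "real \<Rightarrow> real" and s a C :: real and n :: nat
  assumes s: "0 < s" "s < 1" and n: "n \<ge> 2"
    and g[measurable]: "g \<in> borel_measurable borel"
    and C: "C \<ge> 0"
    and expansion: "\<And>\<tau>. 0 \<le> \<tau> \<Longrightarrow> \<tau> \<le> 2 \<Longrightarrow> \<bar>g \<tau> - a * (\<tau> - 1)\<bar> \<le> C * (\<tau> - 1)\<^sup>2"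
    and tail: "set_integrable lborel {1<..} (\<lambda>\<tau>. \<bar>g \<tau>\<bar> * \<tau> powr (- 1 - 2 * s))"
begin

private abbreviation "ker \<equiv> ang_ker n (n + 2 * s)"

lemma ker_measurable[measurable]:
  "(\<lambda>\<tau>. ker \<delta> \<tau>) \<in> borel_measurable borel" "(\<lambda>\<tau>. ker (\<delta> * \<tau>) \<tau>) \<in> borel_measurable borel"
  by (rule ang_ker_measurable; measurable)+

lemma ker_antimono: "\<tau> > 1 \<Longrightarrow> \<delta> \<le> \<delta>' \<Longrightarrow> ker \<delta>' \<tau> \<le> ker \<delta> \<tau>"
  using n s by (intro ang_ker_antimono) auto

lemma g_linear_bound:
  assumes "0 \<le> \<tau>" "\<tau> \<le> 2"
  shows "\<bar>g \<tau>\<bar> \<le> (\<bar>a\<bar> + C) * \<bar>\<tau> - 1\<bar>"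
proof -
  have "\<bar>\<tau> - 1\<bar> * \<bar>\<tau> - 1\<bar> \<le> \<bar>\<tau> - 1\<bar> * 1" using assms by (intro mult_left_mono) auto
  then have "C * (\<tau> - 1)\<^sup>2 \<le> C * \<bar>\<tau> - 1\<bar>" using C by (intro mult_left_mono) (auto simp: power2_eq_square)
  then show ?thesis
    using expansion[OF assms] abs_triangle_ineq[of "g \<tau> - a * (\<tau> - 1)" "a * (\<tau> - 1)"]
    by (simp add: abs_mult distrib_right)
qed

text \<open>The first bound supplies one factor \<open>\<delta>\<close> in the error estimate; the
  second serves integrability.\<close>

lemma g_inverse_bound:
  assumes "\<tau> > 1"
  shows "\<bar>g (1 / \<tau>)\<bar> \<le> (\<bar>a\<bar> + C) * (\<tau> - 1)" "\<bar>g (1 / \<tau>)\<bar> \<le> \<bar>a\<bar> + C"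
proof -
  have t: "0 \<le> 1 / \<tau>" "1 / \<tau> \<le> 2" "\<bar>1 / \<tau> - 1\<bar> \<le> 1" using assms by (auto simp: field_simps)
  have "(\<tau> - 1) * 1 \<le> (\<tau> - 1) * \<tau>" using assms by (intro mult_left_mono) auto
  then have "\<bar>1 / \<tau> - 1\<bar> \<le> \<tau> - 1" using assms by (simp add: field_simps)
  with g_linear_bound[OF t(1,2)] C show "\<bar>g (1 / \<tau>)\<bar> \<le> (\<bar>a\<bar> + C) * (\<tau> - 1)"
    by (elim order_trans) (intro mult_left_mono, auto)
  have "(\<bar>a\<bar> + C) * \<bar>1 / \<tau> - 1\<bar> \<le> (\<bar>a\<bar> + C) * 1" using t C by (intro mult_left_mono) auto
  with g_linear_bound[OF t(1,2)] show "\<bar>g (1 / \<tau>)\<bar> \<le> \<bar>a\<bar> + C" by simp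
qed

text \<open>Inversion gives the reflected part the weight \<open>\<tau> powr (2 * s - 1)\<close>.
  Factoring out the common \<open>\<tau> ^ (n - 1)\<close> leaves the exponent 2s-n.\<close>

definition folded :: "real \<Rightarrow> real" where
  "folded \<tau> = g \<tau> + g (1 / \<tau>) * \<tau> powr (2 * s - n)"

lemma folded_measurable[measurable]: "folded \<in> borel_measurable borel"
  unfolding folded_def[abs_def] by measurable

text \<open>The first-order terms of \<open>g \<tau>\<close> and \<open>g (1 / \<tau>)\<close> cancel.\<close>
lemma folded_quadratic:
  assumes t: "1 < \<tau>" "\<tau> \<le> 2"
  shows "\<bar>folded \<tau>\<bar> \<le> (\<bar>a\<bar> * (n + 1 - 2 * s) + 2 * C) * (\<tau> - 1)\<^sup>2"
proof -
  \<comment> \<open>The first-order terms add up to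
    \<open>a * (\<tau> - 1) * (1 - w / \<tau>)\<close>, where
    \<open>w / \<tau> = \<tau> powr (- p)\<close>. The last factor is at most
    \<open>p * (\<tau> - 1)\<close> and provides the second zero.\<close>
  define p where "p = n + 1 - 2 * s"
  have p: "p > 0" using n s by (simp add: p_def)
  define w where "w = \<tau> powr (2 * s - n)"
  have w: "0 \<le> w" "w \<le> 1" using t n s powr_mono[of "2 * s - n" 0 \<tau>] by (auto simp: w_def)
  have wp: "w / \<tau> = \<tau> powr (- p)" using t by (simp add: w_def p_def powr_diff powr_add powr_minus field_simps)
  have "1 + (- p * ln \<tau>) \<le> exp (- p * ln \<tau>)" by (rule exp_ge_add_one_self)
  moreover have "p * ln \<tau> \<le> p * (\<tau> - 1)" using p t by (intro mult_left_mono ln_le_minus_one) auto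
  ultimately have "1 - p * (\<tau> - 1) \<le> w / \<tau>" unfolding wp using t by (simp add: powr_def)
  moreover have "w / \<tau> \<le> 1" unfolding wp using t p powr_mono[of "- p" 0 \<tau>] by simp
  ultimately have w1: "\<bar>1 - w / \<tau>\<bar> \<le> p * (\<tau> - 1)" by simp
  define e1 where "e1 = g \<tau> - a * (\<tau> - 1)"
  define e2 where "e2 = g (1 / \<tau>) - a * (1 / \<tau> - 1)"
  have e1: "\<bar>e1\<bar> \<le> C * (\<tau> - 1)\<^sup>2" using expansion[of \<tau>] t by (simp add: e1_def)
  have "\<bar>1 / \<tau> - 1\<bar> \<le> \<bar>\<tau> - 1\<bar>"
  proof -
    have "(\<tau> - 1) * 1 \<le> (\<tau> - 1) * \<tau>" using t by (intro mult_left_mono) auto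
    then show ?thesis using t by (simp add: field_simps)
  qed
  then have "(1 / \<tau> - 1)\<^sup>2 \<le> (\<tau> - 1)\<^sup>2" by (rule abs_le_square_iff[THEN iffD1])
  then have "C * (1 / \<tau> - 1)\<^sup>2 \<le> C * (\<tau> - 1)\<^sup>2" using C by (rule mult_left_mono)
  moreover have "0 \<le> 1 / \<tau>" "1 / \<tau> \<le> 2" using t by (auto simp: field_simps)
  ultimately have e2: "\<bar>e2\<bar> \<le> C * (\<tau> - 1)\<^sup>2" using expansion[of "1 / \<tau>"] by (simp add: e2_def)
  have "\<bar>e2 * w\<bar> \<le> \<bar>e2\<bar> * 1" unfolding abs_mult using w by (intro mult_left_mono) auto
  with e2 have e2w: "\<bar>e2 * w\<bar> \<le> C * (\<tau> - 1)\<^sup>2" by simp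
  have "\<bar>a * (\<tau> - 1) * (1 - w / \<tau>)\<bar> \<le> \<bar>a\<bar> * (\<tau> - 1) * (p * (\<tau> - 1))"
    unfolding abs_mult using w1 t by (intro mult_mono) auto
  then have main: "\<bar>a * (\<tau> - 1) * (1 - w / \<tau>)\<bar> \<le> \<bar>a\<bar> * p * (\<tau> - 1)\<^sup>2"
    by (simp add: power2_eq_square mult_ac)
  have "folded \<tau> = g \<tau> + g (1 / \<tau>) * w" by (simp only: folded_def w_def)
  then have "folded \<tau> = a * (\<tau> - 1) * (1 - w / \<tau>) + e1 + e2 * w"
    using t by (simp add: e1_def e2_def field_simps)
  moreover have tri: "\<bar>x + y + z\<bar> \<le> \<bar>x\<bar> + \<bar>y\<bar> + \<bar>z\<bar>" for x y z :: real by linarith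
  ultimately have "\<bar>folded \<tau>\<bar> \<le> \<bar>a\<bar> * p * (\<tau> - 1)\<^sup>2 + C * (\<tau> - 1)\<^sup>2 + C * (\<tau> - 1)\<^sup>2"
    using order_trans[OF tri add_mono[OF add_mono[OF main e1] e2w]] by (simp only:)
  then show ?thesis by (simp add: p_def algebra_simps)
qed

section \<open>Folding the unit interval onto (1, infinity)\<close>

lemma integrable_outer:
  assumes d: "\<delta> > 0"
  shows "set_integrable lborel {1<..} (\<lambda>\<tau>. g \<tau> * (\<tau> ^ (n - 1) * ker \<delta> \<tau>))"
proof -
  obtain B where B: "B \<ge> 0" "\<And>\<tau>. \<tau> \<ge> 1 \<Longrightarrow> \<tau> ^ (n - 1) * ker \<delta> \<tau> \<le> B * \<tau> powr (- 1 - 2 * s)"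
    using ang_ker_far[OF s(1) n d] by blast
  show ?thesis
  proof (rule set_integrable_bound_powr[OF set_integrable_mult_right[OF tail, of B]])
    fix \<tau> :: real assume t: "\<tau> \<in> {1<..}"
    have "\<bar>g \<tau> * (\<tau> ^ (n - 1) * ker \<delta> \<tau>)\<bar> = \<bar>g \<tau>\<bar> * (\<tau> ^ (n - 1) * ker \<delta> \<tau>)"
      using t ang_ker_nonneg[of n "n + 2 * s" \<delta> \<tau>] by (simp add: abs_mult)
    also have "\<dots> \<le> \<bar>g \<tau>\<bar> * (B * \<tau> powr (- 1 - 2 * s))" using t B(2) by (intro mult_left_mono) auto
    finally show "\<bar>g \<tau> * (\<tau> ^ (n - 1) * ker \<delta> \<tau>)\<bar> \<le> B * (\<bar>g \<tau>\<bar> * \<tau> powr (- 1 - 2 * s))"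
      by (simp add: mult_ac)
  qed auto
qed

text \<open>Since 2s < 2 <= n. The reflected part thereby inherits the kernel bounds stated with the
  weight \<open>\<tau> ^ (n - 1)\<close>.\<close>

lemma powr_le_power:
  assumes "\<tau> > 1"
  shows "\<tau> powr (2 * s - 1) \<le> \<tau> ^ (n - 1)"
proof -
  have "\<tau> powr (2 * s - 1) \<le> \<tau> powr (real (n - 1))"
    using assms n s by (intro powr_mono) (auto simp: of_nat_diff)
  also have "\<dots> = \<tau> ^ (n - 1)" using assms by (intro powr_realpow) auto
  finally show ?thesis .
qed

text \<open>A variable threshold \<open>f\<close> covers both kernels that get compared, with
  threshold \<open>\<delta>\<close> and with \<open>\<delta> * \<tau>\<close>.\<close>

lemma integrable_inner:
  assumes d: "\<delta> > 0" and [measurable]: "f \<in> borel_measurable borel" and f: "\<And>\<tau>. \<tau> > 1 \<Longrightarrow> \<delta> \<le> f \<tau>"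
  shows "set_integrable lborel {1<..} (\<lambda>\<tau>. g (1 / \<tau>) * \<tau> powr (2 * s - 1) * ker (f \<tau>) \<tau>)"
proof -
  obtain B where B: "B \<ge> 0" "\<And>\<tau>. \<tau> \<ge> 1 \<Longrightarrow> \<tau> ^ (n - 1) * ker \<delta> \<tau> \<le> B * \<tau> powr (- 1 - 2 * s)"
    using ang_ker_far[OF s(1) n d] by blast
  have [measurable]: "(\<lambda>\<tau>. ker (f \<tau>) \<tau>) \<in> borel_measurable borel" by (rule ang_ker_measurable) fact
  show ?thesis
  proof (rule set_integrable_bound_powr[OF set_integrable_mult_right[OF set_integrable_powr_to_inf[OF s(1)], of "(\<bar>a\<bar> + C) * B"]])
    fix \<tau> :: real assume "\<tau> \<in> {1<..}"
    then have t: "\<tau> > 1" by simp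
    have "\<tau> powr (2 * s - 1) * ker (f \<tau>) \<tau> \<le> \<tau> ^ (n - 1) * ker \<delta> \<tau>"
      using t powr_le_power[OF t] ker_antimono[OF t f[OF t]] ang_ker_nonneg by (intro mult_mono) auto
    also have "\<dots> \<le> B * \<tau> powr (- 1 - 2 * s)" using B(2) t by simp
    finally have "\<bar>g (1 / \<tau>)\<bar> * (\<tau> powr (2 * s - 1) * ker (f \<tau>) \<tau>) \<le> (\<bar>a\<bar> + C) * (B * \<tau> powr (- 1 - 2 * s))"
      by (rule mult_mono[OF g_inverse_bound(2)[OF t]]) (use C ang_ker_nonneg in auto)
    then show "\<bar>g (1 / \<tau>) * \<tau> powr (2 * s - 1) * ker (f \<tau>) \<tau>\<bar> \<le> (\<bar>a\<bar> + C) * B * \<tau> powr (- 1 - 2 * s)"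
      using ang_ker_nonneg[of n "n + 2 * s" "f \<tau>" \<tau>] by (simp add: abs_mult mult.assoc)
  qed auto
qed

lemma
  assumes d: "\<delta> > 0"
  shows integrable_unit_interval: "set_integrable lborel {0<..<1} (\<lambda>\<tau>. g \<tau> * (\<tau> ^ (n - 1) * ker \<delta> \<tau>))"
    and integral_unit_interval: "(LBINT \<tau>:{0<..<1}. g \<tau> * (\<tau> ^ (n - 1) * ker \<delta> \<tau>))
      = (LBINT \<tau>:{1<..}. g (1 / \<tau>) * \<tau> powr (2 * s - 1) * ker (\<delta> * \<tau>) \<tau>)"
proof -
  \<comment> \<open>Exponents: -(n-1) from the inverted power, -2 from the Jacobian and n+2s from
    \<open>ang_ker_inverse\<close> sum to 2s-1.\<close>
  have eq: "g (1 / \<tau>) * ((1 / \<tau>) ^ (n - 1) * ker \<delta> (1 / \<tau>)) / \<tau>\<^sup>2 = g (1 / \<tau>) * \<tau> powr (2 * s - 1) * ker (\<delta> * \<tau>) \<tau>"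
    if "\<tau> > 1" for \<tau>
  proof -
    have k: "ker \<delta> (1 / \<tau>) = \<tau> powr (n + 2 * s) * ker (\<delta> * \<tau>) \<tau>"
      using that by (intro ang_ker_inverse) simp
    have "(1 / \<tau>) ^ (n - 1) / \<tau>\<^sup>2 = 1 / \<tau> ^ (n + 1)"
    proof -
      obtain j where j: "n = j + 2" using n by (metis le_add_diff_inverse2)
      show ?thesis by (simp add: j power_divide power2_eq_square power_add)
    qed
    also have "\<dots> = \<tau> powr (- real (n + 1))"
      using that by (simp only: powr_minus_divide powr_realpow[of \<tau>])
    finally have "(1 / \<tau>) ^ (n - 1) * \<tau> powr (n + 2 * s) / \<tau>\<^sup>2 = \<tau> powr (- real (n + 1)) * \<tau> powr (n + 2 * s)"
      by (simp only: times_divide_eq_left[symmetric])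
    also have "\<dots> = \<tau> powr (2 * s - 1)"
      unfolding powr_add[symmetric] by (rule arg_cong[where f="\<lambda>p. \<tau> powr p"]) simp
    finally have E: "(1 / \<tau>) ^ (n - 1) * \<tau> powr (n + 2 * s) / \<tau>\<^sup>2 = \<tau> powr (2 * s - 1)" .
    have "x * (A * (P * k)) / T = x * (A * P / T) * k" for x A P k T :: real by simp
    then show ?thesis unfolding k by (simp only: E)
  qed
  have "set_integrable lborel {1<..} (\<lambda>\<tau>. g (1 / \<tau>) * \<tau> powr (2 * s - 1) * ker (\<delta> * \<tau>) \<tau>)"
    using d by (intro integrable_inner[OF d]) auto
  then have "set_integrable lborel {1<..} (\<lambda>\<tau>. g (1 / \<tau>) * ((1 / \<tau>) ^ (n - 1) * ker \<delta> (1 / \<tau>)) / \<tau>\<^sup>2)"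
    by (subst set_integrable_cong[OF refl refl eq]) auto
  note fold = set_integral_fold_inverse[OF _ this]
  show "set_integrable lborel {0<..<1} (\<lambda>\<tau>. g \<tau> * (\<tau> ^ (n - 1) * ker \<delta> \<tau>))"
    by (rule fold(1)) measurable
  have "(LBINT \<tau>:{0<..<1}. g \<tau> * (\<tau> ^ (n - 1) * ker \<delta> \<tau>))
      = (LBINT \<tau>:{1<..}. g (1 / \<tau>) * ((1 / \<tau>) ^ (n - 1) * ker \<delta> (1 / \<tau>)) / \<tau>\<^sup>2)"
    by (rule fold(2)) measurable
  also have "\<dots> = (LBINT \<tau>:{1<..}. g (1 / \<tau>) * \<tau> powr (2 * s - 1) * ker (\<delta> * \<tau>) \<tau>)"
    by (rule set_lebesgue_integral_cong) (simp, use eq in blast)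
  finally show "(LBINT \<tau>:{0<..<1}. g \<tau> * (\<tau> ^ (n - 1) * ker \<delta> \<tau>))
      = (LBINT \<tau>:{1<..}. g (1 / \<tau>) * \<tau> powr (2 * s - 1) * ker (\<delta> * \<tau>) \<tau>)" .
qed

definition pv_error :: "real \<Rightarrow> real" where
  "pv_error \<delta> = (LBINT \<tau>:{1<..}. g (1 / \<tau>) * \<tau> powr (2 * s - 1) * (ker \<delta> \<tau> - ker (\<delta> * \<tau>) \<tau>))"

lemma
  assumes d: "\<delta> > 0"
  shows integrable_positive: "set_integrable lborel {0<..} (\<lambda>\<tau>. g \<tau> * (\<tau> ^ (n - 1) * ker \<delta> \<tau>))"
    and integral_positive: "(LBINT \<tau>:{0<..}. g \<tau> * (\<tau> ^ (n - 1) * ker \<delta> \<tau>))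
      = (LBINT \<tau>:{1<..}. folded \<tau> * (\<tau> ^ (n - 1) * ker \<delta> \<tau>)) - pv_error \<delta>"
proof -
  let ?f = "\<lambda>\<tau>. g \<tau> * (\<tau> ^ (n - 1) * ker \<delta> \<tau>)"
  let ?h = "\<lambda>d \<tau>. g (1 / \<tau>) * \<tau> powr (2 * s - 1) * ker d \<tau>"
  note i1 = integrable_unit_interval[OF d] and i2 = integrable_outer[OF d]
  have i3: "set_integrable lborel {1<..} (\<lambda>\<tau>. ?h \<delta> \<tau>)" by (intro integrable_inner[OF d]) auto
  have i4: "set_integrable lborel {1<..} (\<lambda>\<tau>. ?h (\<delta> * \<tau>) \<tau>)" using d by (intro integrable_inner[OF d]) auto
  have un: "set_integrable lborel ({0<..<1} \<union> {1<..}) ?f"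
    by (rule set_integrable_Un[OF i1 i2]) auto
  have ae: "AE \<tau> in lborel. \<tau> \<in> {0<..<1} \<union> {1<..} \<longleftrightarrow> \<tau> \<in> {0::real<..}"
    by (rule AE_I[of _ _ "{1}"]) auto
  have "integrable lborel (\<lambda>\<tau>. indicator {0<..} \<tau> *\<^sub>R ?f \<tau>)"
    by (rule integrable_cong_AE_imp[OF un[unfolded set_integrable_def]])
       (use ae in \<open>auto elim!: eventually_mono simp: indicator_def\<close>)
  then show "set_integrable lborel {0<..} ?f" by (simp add: set_integrable_def)
  have "(LBINT \<tau>:{0<..}. ?f \<tau>) = (LBINT \<tau>:{0<..<1} \<union> {1<..}. ?f \<tau>)"
    unfolding set_lebesgue_integral_def
    by (rule integral_cong_AE) (use ae in \<open>auto elim!: eventually_mono simp: indicator_def\<close>)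
  also have "\<dots> = (LBINT \<tau>:{0<..<1}. ?f \<tau>) + (LBINT \<tau>:{1<..}. ?f \<tau>)"
    by (rule set_integral_Un[OF _ i1 i2]) auto
  also have "(LBINT \<tau>:{0<..<1}. ?f \<tau>) = (LBINT \<tau>:{1<..}. ?h (\<delta> * \<tau>) \<tau>)"
    by (rule integral_unit_interval[OF d])
  also have "(LBINT \<tau>:{1<..}. ?h (\<delta> * \<tau>) \<tau>) = (LBINT \<tau>:{1<..}. ?h \<delta> \<tau>) - pv_error \<delta>"
    unfolding pv_error_def right_diff_distrib using set_integral_diff(2)[OF i3 i4] by simp
  also have "(LBINT \<tau>:{1<..}. ?h \<delta> \<tau>) - pv_error \<delta> + (LBINT \<tau>:{1<..}. ?f \<tau>)
     = (LBINT \<tau>:{1<..}. ?f \<tau> + ?h \<delta> \<tau>) - pv_error \<delta>"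
    using set_integral_add(2)[OF i2 i3] by simp
  also have "(LBINT \<tau>:{1<..}. ?f \<tau> + ?h \<delta> \<tau>) = (LBINT \<tau>:{1<..}. folded \<tau> * (\<tau> ^ (n - 1) * ker \<delta> \<tau>))"
  proof (rule set_lebesgue_integral_cong)
    show "\<forall>\<tau>. \<tau> \<in> {1<..} \<longrightarrow> ?f \<tau> + ?h \<delta> \<tau> = folded \<tau> * (\<tau> ^ (n - 1) * ker \<delta> \<tau>)"
    proof safe
      fix \<tau> :: real assume "1 < \<tau>"
      then have "\<tau> powr (2 * s - n) * \<tau> ^ (n - 1) = \<tau> powr (2 * s - n) * \<tau> powr real (n - 1)"
        by (subst powr_realpow) auto
      also have "\<dots> = \<tau> powr (2 * s - 1)"
        unfolding powr_add[symmetric] using n by (intro arg_cong[where f="\<lambda>p. \<tau> powr p"]) (simp add: of_nat_diff)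
      finally have "\<tau> powr (2 * s - 1) = \<tau> powr (2 * s - n) * \<tau> ^ (n - 1)" ..
      moreover have "x * (P * k) + y * (W * P) * k = (x + y * W) * (P * k)" for x y P W k :: real
        by (simp add: algebra_simps)
      ultimately show "?f \<tau> + ?h \<delta> \<tau> = folded \<tau> * (\<tau> ^ (n - 1) * ker \<delta> \<tau>)"
        by (simp only: folded_def)
    qed
  qed auto
  finally show "(LBINT \<tau>:{0<..}. ?f \<tau>) = (LBINT \<tau>:{1<..}. folded \<tau> * (\<tau> ^ (n - 1) * ker \<delta> \<tau>)) - pv_error \<delta>" .
qed

section \<open>Passage to the limit\<close>

lemma integrable_folded: "set_integrable lborel {1<..} (\<lambda>\<tau>. folded \<tau> * (\<tau> ^ (n - 1) * ker 0 \<tau>))"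
proof -
  have knn: "ker 0 \<tau> \<ge> 0" for \<tau> by (rule ang_ker_nonneg)
  obtain B where B: "B \<ge> 0" "\<And>\<tau>. 1 < \<tau> \<Longrightarrow> \<tau> \<le> 2 \<Longrightarrow> \<tau> ^ (n - 1) * ker 0 \<tau> \<le> B * (\<tau> - 1) powr (- 1 - 2 * s)"
    using ang_ker_0_near[OF s(1) n] by blast
  obtain E where E: "E \<ge> 0" "\<And>\<tau>. \<tau> \<ge> 2 \<Longrightarrow> \<tau> ^ (n - 1) * ker 0 \<tau> \<le> E * \<tau> powr (- 1 - 2 * s)"
    using ang_ker_0_far[OF s(1) n] by blast
  define A where "A = \<bar>a\<bar> * (n + 1 - 2 * s) + 2 * C"
  have A: "A \<ge> 0" using n s C by (simp add: A_def)
  \<comment> \<open>Near 1 the second-order zero of \<open>folded\<close> against the exponent -1-2s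
    leaves \<open>(\<tau> - 1) powr (1 - 2 * s)\<close>, integrable because s < 1.\<close>
  have "set_integrable lborel {1<..2} (\<lambda>\<tau>. folded \<tau> * (\<tau> ^ (n - 1) * ker 0 \<tau>))"
  proof (rule set_integrable_bound_powr[OF set_integrable_mult_right[OF set_integrable_powr_near_1[OF s(2)], of "A * B"]])
    fix \<tau> :: real assume "\<tau> \<in> {1<..2}"
    then have t: "1 < \<tau>" "\<tau> \<le> 2" by auto
    have "\<bar>folded \<tau> * (\<tau> ^ (n - 1) * ker 0 \<tau>)\<bar> = \<bar>folded \<tau>\<bar> * (\<tau> ^ (n - 1) * ker 0 \<tau>)"
      using t knn by (simp add: abs_mult)
    also have "\<dots> \<le> (A * (\<tau> - 1)\<^sup>2) * (B * (\<tau> - 1) powr (- 1 - 2 * s))"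
      by (rule mult_mono[OF folded_quadratic[OF t, folded A_def] B(2)[OF t]]) (use A t knn in auto)
    also have "\<dots> = A * B * ((\<tau> - 1)\<^sup>2 * (\<tau> - 1) powr (- 1 - 2 * s))" by simp
    also have "(\<tau> - 1)\<^sup>2 = (\<tau> - 1) powr 2" using t by simp
    also have "(\<tau> - 1) powr 2 * (\<tau> - 1) powr (- 1 - 2 * s) = (\<tau> - 1) powr (1 - 2 * s)"
      unfolding powr_add[symmetric] by simp
    finally show "\<bar>folded \<tau> * (\<tau> ^ (n - 1) * ker 0 \<tau>)\<bar> \<le> A * B * (\<tau> - 1) powr (1 - 2 * s)" .
  qed auto
  moreover have "set_integrable lborel {2<..} (\<lambda>\<tau>. folded \<tau> * (\<tau> ^ (n - 1) * ker 0 \<tau>))"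
  proof -
    have "set_integrable lborel {1<..} (\<lambda>\<tau>. E * (\<bar>g \<tau>\<bar> * \<tau> powr (- 1 - 2 * s)) + E * (\<bar>a\<bar> + C) * \<tau> powr (- 1 - 2 * s))"
      by (intro set_integral_add(1) set_integrable_mult_right tail set_integrable_powr_to_inf s)
    then have "set_integrable lborel {2<..} (\<lambda>\<tau>. E * (\<bar>g \<tau>\<bar> * \<tau> powr (- 1 - 2 * s)) + E * (\<bar>a\<bar> + C) * \<tau> powr (- 1 - 2 * s))"
      by (rule set_integrable_subset) auto
    then show ?thesis
    proof (rule set_integrable_bound_powr)
      fix \<tau> :: real assume "\<tau> \<in> {2<..}"
      then have t: "\<tau> > 1" "\<tau> \<ge> 2" by auto
      have "\<tau> powr (2 * s - n) \<le> 1" using t n s powr_mono[of "2 * s - n" 0 \<tau>] by simp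
      then have "\<bar>g (1 / \<tau>)\<bar> * \<tau> powr (2 * s - n) \<le> (\<bar>a\<bar> + C) * 1"
        using g_inverse_bound(2)[OF t(1)] C by (intro mult_mono) auto
      then have "\<bar>folded \<tau>\<bar> \<le> \<bar>g \<tau>\<bar> + (\<bar>a\<bar> + C)"
        unfolding folded_def by (intro order_trans[OF abs_triangle_ineq]) (simp add: abs_mult)
      then have "\<bar>folded \<tau>\<bar> * (\<tau> ^ (n - 1) * ker 0 \<tau>) \<le> (\<bar>g \<tau>\<bar> + (\<bar>a\<bar> + C)) * (E * \<tau> powr (- 1 - 2 * s))"
        by (rule mult_mono[OF _ E(2)[OF t(2)]]) (use t knn C in auto)
      then show "\<bar>folded \<tau> * (\<tau> ^ (n - 1) * ker 0 \<tau>)\<bar>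
        \<le> E * (\<bar>g \<tau>\<bar> * \<tau> powr (- 1 - 2 * s)) + E * (\<bar>a\<bar> + C) * \<tau> powr (- 1 - 2 * s)"
        using t knn by (simp add: abs_mult algebra_simps)
    qed auto
  qed
  ultimately have "set_integrable lborel ({1<..2} \<union> {2<..}) (\<lambda>\<tau>. folded \<tau> * (\<tau> ^ (n - 1) * ker 0 \<tau>))"
    by (rule set_integrable_Un) auto
  also have "{1<..2} \<union> {2<..} = {1::real<..}" by auto
  finally show ?thesis .
qed

text \<open>For fixed \<open>\<tau> > 1\<close> the kernel equals its untruncated value once
  \<open>\<delta> < \<tau> - 1\<close>, and by monotonicity the limit integrand itself dominates.
  Setting \<open>\<delta> = inverse i\<close> fits dominated convergence at infinity.\<close>

lemma folded_limit:
  "((\<lambda>\<delta>. LBINT \<tau>:{1<..}. folded \<tau> * (\<tau> ^ (n - 1) * ker \<delta> \<tau>))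
     \<longlongrightarrow> (LBINT \<tau>:{1<..}. folded \<tau> * (\<tau> ^ (n - 1) * ker 0 \<tau>))) (at_right 0)"
  unfolding filterlim_at_right_to_top set_lebesgue_integral_def
proof (rule integral_dominated_convergence_at_top[where w="\<lambda>\<tau>. norm (indicator {1<..} \<tau> *\<^sub>R (folded \<tau> * (\<tau> ^ (n - 1) * ker 0 \<tau>)))"])
  show "integrable lborel (\<lambda>\<tau>. norm (indicator {1<..} \<tau> *\<^sub>R (folded \<tau> * (\<tau> ^ (n - 1) * ker 0 \<tau>))))"
    using integrable_folded unfolding set_integrable_def by (rule integrable_norm)
  show "AE \<tau> in lborel. ((\<lambda>i. indicator {1<..} \<tau> *\<^sub>R (folded \<tau> * (\<tau> ^ (n - 1) * ker (inverse i) \<tau>)))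
     \<longlongrightarrow> indicator {1<..} \<tau> *\<^sub>R (folded \<tau> * (\<tau> ^ (n - 1) * ker 0 \<tau>))) at_top"
  proof (rule AE_I2)
    fix \<tau> :: real
    show "((\<lambda>i. indicator {1<..} \<tau> *\<^sub>R (folded \<tau> * (\<tau> ^ (n - 1) * ker (inverse i) \<tau>)))
     \<longlongrightarrow> indicator {1<..} \<tau> *\<^sub>R (folded \<tau> * (\<tau> ^ (n - 1) * ker 0 \<tau>))) at_top"
    proof (cases "\<tau> > 1")
      case True
      have "eventually (\<lambda>i. ker 0 \<tau> = ker (inverse i) \<tau>) at_top"
        using eventually_gt_at_top[of "1 / (\<tau> - 1)"] eventually_gt_at_top[of 0]
      proof eventually_elim
        case (elim i)
        then have "inverse i < \<bar>\<tau> - 1\<bar>" using True by (simp add: field_simps)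
        then show ?case using elim True by (intro ang_ker_eq_0[symmetric]) auto
      qed
      then have "((\<lambda>i. ker (inverse i) \<tau>) \<longlongrightarrow> ker 0 \<tau>) at_top" by (rule tendsto_eventually[OF eventually_mono]) simp
      then show ?thesis by (intro tendsto_intros)
    qed simp
  qed
  show "\<forall>\<^sub>F i in at_top. AE \<tau> in lborel. norm (indicator {1<..} \<tau> *\<^sub>R (folded \<tau> * (\<tau> ^ (n - 1) * ker (inverse i) \<tau>)))
     \<le> norm (indicator {1<..} \<tau> *\<^sub>R (folded \<tau> * (\<tau> ^ (n - 1) * ker 0 \<tau>)))"
    using eventually_gt_at_top[of 0]
  proof eventually_elim
    case (elim i)
    show ?case
    proof (rule AE_I2)
      fix \<tau> :: real
      have "0 \<le> ker (inverse i) \<tau>" "0 \<le> ker 0 \<tau>" by (simp_all add: ang_ker_nonneg)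
      then show "norm (indicator {1<..} \<tau> *\<^sub>R (folded \<tau> * (\<tau> ^ (n - 1) * ker (inverse i) \<tau>)))
        \<le> norm (indicator {1<..} \<tau> *\<^sub>R (folded \<tau> * (\<tau> ^ (n - 1) * ker 0 \<tau>)))"
        using ker_antimono[of \<tau> 0 "inverse i"] elim
        by (auto simp: indicator_def abs_mult intro!: mult_left_mono)
    qed
  qed
qed auto

text \<open>The type \<open>'m\<close> realises the number \<open>n\<close> as a dimension, because
  the estimate needs an actual shell in R^n. The order is \<delta> from \<open>g\<close>,
  \<delta>^(-n-2s) from the kernel and \<delta>^(n+1) from the shell volume, so \<delta>^(2-2s) in
  total.\<close>

lemma pv_error_limit:
  assumes card: "n = CARD('m::finite)"
  shows "(pv_error \<longlongrightarrow> 0) (at_right 0)"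
proof -
  define N where "N = n + 2 * s"
  define L where "L = \<bar>a\<bar> + C"
  have L: "L \<ge> 0" using C by (simp add: L_def)
  define c where "c = real (n - 1) * unit_ball_vol (real (n - 1))"
  have c: "c > 0" using n by (simp add: c_def)
  define V where "V = unit_ball_vol (real n)"
  have V: "V > 0" by (simp add: V_def)
  define A where "A = 2 * L / c * (V * 2 ^ n * 2)"
  have bound: "\<bar>pv_error \<delta>\<bar> \<le> A * \<delta> powr (2 - 2 * s)" if d: "0 < \<delta>" "\<delta> < 1 / 2" for \<delta>
  proof -
    \<comment> \<open>The two kernels can differ only if
      \<open>\<tau> - 1 \<le> \<delta> * \<tau>\<close>. For \<open>\<delta> < 1 / 2\<close> this
      forces \<open>\<tau> \<le> 1 + 2 * \<delta>\<close>, so \<open>\<delta>'\<close> bounds every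
      threshold \<open>\<delta> * \<tau>\<close> that matters and is itself independent of
      \<open>\<tau>\<close>.\<close>
    define \<delta>' where "\<delta>' = \<delta> * (1 + 2 * \<delta>)"
    have d': "\<delta> \<le> \<delta>'" "\<delta>' > 0" using d by (auto simp: \<delta>'_def intro: mult_pos_pos)
    let ?D = "\<lambda>\<tau>. \<tau> ^ (n - 1) * (ker \<delta> \<tau> - ker \<delta>' \<tau>)"
    let ?e = "\<lambda>\<tau>. g (1 / \<tau>) * \<tau> powr (2 * s - 1) * (ker \<delta> \<tau> - ker (\<delta> * \<tau>) \<tau>)"
    have D0: "?D \<tau> \<ge> 0" if "\<tau> > 0" for \<tau>
      using that d d' n s ang_ker_antimono_pos[of n "n + 2 * s" \<delta> \<delta>' \<tau>] by simp
    have iD: "set_integrable lborel {0<..} ?D"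
      unfolding right_diff_distrib by (intro set_integral_diff(1) set_integrable_ang_ker s n d d')
    have pw: "\<bar>?e \<tau>\<bar> \<le> 2 * L * \<delta> * ?D \<tau>" if t: "\<tau> > 1" for \<tau>
    proof (cases "\<delta> * \<tau> < \<tau> - 1")
      case True
      \<comment> \<open>Both thresholds lie below the radial gap, so both kernels are untruncated
        and the error integrand vanishes.\<close>
      have "\<delta> * 1 \<le> \<delta> * \<tau>" using d t by (intro mult_left_mono) auto
      with True have lt: "\<delta> * \<tau> < \<bar>\<tau> - 1\<bar>" "\<delta> < \<bar>\<tau> - 1\<bar>" by auto
      have "ker \<delta> \<tau> = ker 0 \<tau>" "ker (\<delta> * \<tau>) \<tau> = ker 0 \<tau>"
        using lt d t by (intro ang_ker_eq_0; simp)+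
      then show ?thesis using D0[of \<tau>] t L d by simp
    next
      case False
      have le: "\<tau> \<le> 1 + 2 * \<delta>"
      proof (rule ccontr)
        assume "\<not> ?thesis"
        then have "(1 + 2 * \<delta>) * (1 - \<delta>) < \<tau> * (1 - \<delta>)" using d by (intro mult_strict_right_mono) auto
        also have "\<tau> * (1 - \<delta>) \<le> 1" using False by (simp add: algebra_simps)
        finally have "\<delta> * (1 - 2 * \<delta>) < 0" by (simp add: algebra_simps)
        moreover have "0 \<le> \<delta> * (1 - 2 * \<delta>)" using d by (intro mult_nonneg_nonneg) auto
        ultimately show False by simp
      qed
      have "\<bar>g (1 / \<tau>)\<bar> \<le> L * (\<tau> - 1)" using g_inverse_bound(1)[OF t] by (simp add: L_def)
      also have "\<dots> \<le> L * (2 * \<delta>)" using le L by (intro mult_left_mono) auto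
      finally have g1: "\<bar>g (1 / \<tau>)\<bar> \<le> 2 * L * \<delta>" by simp
      have "\<delta> * \<tau> \<le> \<delta>'" unfolding \<delta>'_def using le d by (intro mult_left_mono) auto
      then have k: "ker \<delta>' \<tau> \<le> ker (\<delta> * \<tau>) \<tau>" by (rule ker_antimono[OF t])
      have "\<delta> * 1 \<le> \<delta> * \<tau>" using d t by (intro mult_left_mono) auto
      then have k2: "ker (\<delta> * \<tau>) \<tau> \<le> ker \<delta> \<tau>" using ker_antimono[OF t, of \<delta> "\<delta> * \<tau>"] by simp
      have "\<bar>?e \<tau>\<bar> = \<bar>g (1 / \<tau>)\<bar> * (\<tau> powr (2 * s - 1) * (ker \<delta> \<tau> - ker (\<delta> * \<tau>) \<tau>))"
        using k2 by (simp add: abs_mult)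
      also have "\<dots> \<le> 2 * L * \<delta> * ?D \<tau>"
      proof (rule mult_mono[OF g1])
        show "\<tau> powr (2 * s - 1) * (ker \<delta> \<tau> - ker (\<delta> * \<tau>) \<tau>) \<le> ?D \<tau>"
          using powr_le_power[OF t] k k2 t by (intro mult_mono) auto
      qed (use L d k2 in auto)
      finally show ?thesis .
    qed
    have i3: "set_integrable lborel {1<..} (\<lambda>\<tau>. g (1 / \<tau>) * \<tau> powr (2 * s - 1) * ker \<delta> \<tau>)"
      by (intro integrable_inner[OF d(1)]) auto
    have i4: "set_integrable lborel {1<..} (\<lambda>\<tau>. g (1 / \<tau>) * \<tau> powr (2 * s - 1) * ker (\<delta> * \<tau>) \<tau>)"
      using d by (intro integrable_inner[OF d(1)]) auto
    have ie: "set_integrable lborel {1<..} ?e"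
      unfolding right_diff_distrib by (rule set_integral_diff(1)[OF i3 i4])
    have iD': "integrable lborel (\<lambda>\<tau>. 2 * L * \<delta> * (indicator {0<..} \<tau> * ?D \<tau>))"
      using iD unfolding set_integrable_def real_scaleR_def by (rule integrable_mult_right)
    have "\<bar>pv_error \<delta>\<bar> \<le> (\<integral>\<tau>. norm (indicator {1<..} \<tau> *\<^sub>R ?e \<tau>) \<partial>lborel)"
      unfolding pv_error_def set_lebesgue_integral_def real_norm_def[symmetric] by (rule integral_norm_bound)
    also have "\<dots> \<le> (\<integral>\<tau>. 2 * L * \<delta> * (indicator {0<..} \<tau> * ?D \<tau>) \<partial>lborel)"
    proof (rule integral_mono[OF integrable_norm[OF ie[unfolded set_integrable_def]] iD'])
      fix \<tau> :: real
      show "norm (indicator {1<..} \<tau> *\<^sub>R ?e \<tau>) \<le> 2 * L * \<delta> * (indicator {0<..} \<tau> * ?D \<tau>)"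
        using pw[of \<tau>] D0[of \<tau>] L d by (auto simp: indicator_def)
    qed
    also have "\<dots> = 2 * L * \<delta> * (LBINT \<tau>:{0<..}. ?D \<tau>)"
      by (simp add: set_lebesgue_integral_def)
    also have "\<dots> = 2 * L * \<delta> / c * (c * (LBINT \<tau>:{0<..}. ?D \<tau>))" using c by simp
    also have "\<dots> \<le> 2 * L * \<delta> / c * (\<delta> powr (- N) * (V * (\<delta>' ^ n - \<delta> ^ n)))"
      using ang_ker_shell[where 'n='m, OF s(1) _ d(1) d'(1)] n L c d
      by (intro mult_left_mono) (auto simp: card[symmetric] c_def N_def V_def)
    also have "\<dots> \<le> 2 * L * \<delta> / c * (\<delta> powr (- N) * (V * (\<delta> ^ n * (2 ^ n * (2 * \<delta>)))))"
    proof -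
      \<comment> \<open>By convexity the power lies below its chord over [0, 1]; used with
        \<open>x = 2 * \<delta>\<close>, it makes the relative thickness of the shell linear in
        \<open>\<delta>\<close>.\<close>
      have aux: "(1 + x) ^ k \<le> 1 + (2 ^ k - 1) * x" if "0 \<le> x" "x \<le> 1" for x :: real and k :: nat
      proof (induction k)
        case (Suc k)
        have p: "(1::real) \<le> 2 ^ k" by simp
        have "(1 + x) ^ Suc k \<le> (1 + (2 ^ k - 1) * x) * (1 + x)"
          using mult_right_mono[OF Suc, of "1 + x"] that by (simp add: mult.commute)
        also have "\<dots> = 1 + 2 ^ k * x + (2 ^ k - 1) * (x * x)" by (simp add: algebra_simps)
        also have "\<dots> \<le> 1 + 2 ^ k * x + (2 ^ k - 1) * (x * 1)"
          using that p by (intro add_left_mono mult_left_mono) auto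
        also have "\<dots> = 1 + (2 ^ Suc k - 1) * x" by (simp add: algebra_simps)
        finally show ?case .
      qed simp
      have "\<delta>' ^ n - \<delta> ^ n = \<delta> ^ n * ((1 + 2 * \<delta>) ^ n - 1)"
        by (simp add: \<delta>'_def power_mult_distrib right_diff_distrib)
      also have "(1 + 2 * \<delta>) ^ n - 1 \<le> 2 ^ n * (2 * \<delta>)"
        using aux[of "2 * \<delta>" n] d by (simp add: algebra_simps)
      finally have "\<delta>' ^ n - \<delta> ^ n \<le> \<delta> ^ n * (2 ^ n * (2 * \<delta>))"
        using d by (simp add: mult_left_mono)
      then show ?thesis using L c d V by (intro mult_left_mono) auto
    qed
    also have "\<dots> = A * (\<delta> * \<delta> * \<delta> ^ n * \<delta> powr (- N))" by (simp add: A_def)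
    also have "\<delta> * \<delta> * \<delta> ^ n * \<delta> powr (- N) = \<delta> powr (2 - 2 * s)"
    proof -
      have "\<delta> * \<delta> * \<delta> ^ n = \<delta> ^ (n + 2)" by (simp add: power_add power2_eq_square)
      also have "\<dots> = \<delta> powr real (n + 2)" using d by (intro powr_realpow[symmetric]) auto
      finally show ?thesis by (simp only: powr_add[symmetric]) (simp add: N_def)
    qed
    finally show ?thesis .
  qed
  have "((\<lambda>\<delta>. A * \<delta> powr (2 - 2 * s)) \<longlongrightarrow> A * 0) (at_right 0)"
    using s by (intro tendsto_mult tendsto_const tendsto_zero_powrI[where b="2 - 2 * s"])
      (auto simp: eventually_at_filter)
  then have lim: "((\<lambda>\<delta>. A * \<delta> powr (2 - 2 * s)) \<longlongrightarrow> 0) (at_right 0)" by simp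
  have "eventually (\<lambda>\<delta>. norm (pv_error \<delta>) \<le> A * \<delta> powr (2 - 2 * s)) (at_right 0)"
    using eventually_at_right_real[of 0 "1 / 2"] by (auto elim!: eventually_mono intro!: bound)
  then show ?thesis by (rule Lim_null_comparison) (rule lim)
qed

lemma pv_limit:
  assumes card: "n = CARD('m::finite)"
  shows "((\<lambda>\<delta>. LBINT \<tau>:{0<..}. g \<tau> * (\<tau> ^ (n - 1) * ker \<delta> \<tau>))
     \<longlongrightarrow> (LBINT \<tau>:{1<..}. folded \<tau> * (\<tau> ^ (n - 1) * ker 0 \<tau>))) (at_right 0)"
proof -
  have "((\<lambda>\<delta>. (LBINT \<tau>:{1<..}. folded \<tau> * (\<tau> ^ (n - 1) * ker \<delta> \<tau>)) - pv_error \<delta>)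
     \<longlongrightarrow> (LBINT \<tau>:{1<..}. folded \<tau> * (\<tau> ^ (n - 1) * ker 0 \<tau>)) - 0) (at_right 0)"
    by (intro tendsto_diff folded_limit pv_error_limit[OF card])
  moreover have "eventually (\<lambda>\<delta>. (LBINT \<tau>:{1<..}. folded \<tau> * (\<tau> ^ (n - 1) * ker \<delta> \<tau>)) - pv_error \<delta>
      = (LBINT \<tau>:{0<..}. g \<tau> * (\<tau> ^ (n - 1) * ker \<delta> \<tau>))) (at_right 0)"
    using eventually_at_right_less[of "0::real"] by eventually_elim (simp only: integral_positive)
  ultimately show ?thesis by (simp add: filterlim_cong[OF refl refl] tendsto_cong)
qed

end

section \<open>The representation formula\<close>

text \<open>For \<open>\<tau> > 1\<close> one has
  \<open>1 + r * \<tau> \<le> (1 + r) * \<tau>\<close>. Hence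
  \<open>\<tau> powr (- 1 - 2 * s)\<close> is at most a constant times the growth weight evaluated
  at \<open>r * \<tau>\<close>, and rescaling the hypothesis by \<open>r\<close> suffices.\<close>

lemma set_integrable_tail:
  fixes v :: "real \<Rightarrow> real" and s r :: real
  assumes r: "r > 0" and s: "0 < s" and v: "continuous_on UNIV v"
    and growth: "(\<lambda>\<rho>. \<bar>v \<rho>\<bar> / (1 + \<rho>) powr (real n + 2 * s) * \<rho> ^ (n - 1)) integrable_on {0..}"
    and n: "n \<ge> 1"
  shows "set_integrable lborel {1<..} (\<lambda>\<tau>. \<bar>b - v (r * \<tau>)\<bar> * \<tau> powr (- 1 - 2 * s))"
proof -
  have [measurable]: "v \<in> borel_measurable borel" using v by (rule borel_measurable_continuous_onI)
  let ?N = "real n + 2 * s"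
  let ?G = "\<lambda>\<rho>. \<bar>v \<rho>\<bar> / (1 + \<rho>) powr ?N * \<rho> ^ (n - 1)"
  have "?G absolutely_integrable_on {0..}"
    by (rule nonnegative_absolutely_integrable_1[OF growth]) auto
  then have "integrable lborel (\<lambda>\<rho>. indicator {0..} \<rho> *\<^sub>R ?G \<rho>)"
    unfolding set_integrable_def by (subst (asm) integrable_completion) auto
  from lborel_integrable_real_affine[OF this, of r 0] r
  have "integrable lborel (\<lambda>\<tau>. indicator {0..} (r * \<tau>) *\<^sub>R ?G (r * \<tau>))" by simp
  also have "(\<lambda>\<tau>. indicator {0..} (r * \<tau>) *\<^sub>R ?G (r * \<tau>)) = (\<lambda>\<tau>. indicator {0..} \<tau> *\<^sub>R ?G (r * \<tau>))"
    using r by (auto simp: indicator_def zero_le_mult_iff)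
  finally have "set_integrable lborel {0..} (\<lambda>\<tau>. ?G (r * \<tau>))" unfolding set_integrable_def .
  then have G: "set_integrable lborel {1<..} (\<lambda>\<tau>. ?G (r * \<tau>))" by (rule set_integrable_subset) auto
  define K where "K = (1 + r) powr ?N / r ^ (n - 1)"
  have K: "K \<ge> 0" using r by (simp add: K_def)
  have "set_integrable lborel {1<..} (\<lambda>\<tau>. \<bar>b\<bar> * \<tau> powr (- 1 - 2 * s) + K * ?G (r * \<tau>))"
    by (intro set_integral_add(1) set_integrable_mult_right set_integrable_powr_to_inf s G)
  then show ?thesis
  proof (rule set_integrable_bound_powr)
    fix \<tau> :: real assume "\<tau> \<in> {1<..}"
    then have t: "\<tau> > 1" by simp
    have "\<tau> powr (- 1 - 2 * s) \<le> K * ((r * \<tau>) ^ (n - 1) / (1 + r * \<tau>) powr ?N)"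
    proof -
      have "1 + r * \<tau> \<le> (1 + r) * \<tau>" using t by (simp add: algebra_simps)
      then have "(1 + r * \<tau>) powr ?N \<le> ((1 + r) * \<tau>) powr ?N"
        using r t s by (intro powr_mono2) (auto intro: add_nonneg_nonneg)
      also have "\<dots> = (1 + r) powr ?N * \<tau> powr ?N" by (rule powr_mult)
      finally have le: "(1 + r * \<tau>) powr ?N \<le> (1 + r) powr ?N * \<tau> powr ?N" .
      have "1 + r * \<tau> > 0" using r t by (intro add_pos_pos mult_pos_pos) auto
      then have pos: "(1 + r * \<tau>) powr ?N > 0" by simp
      have "\<tau> powr (- 1 - 2 * s) = \<tau> powr (real (n - 1)) * \<tau> powr (- ?N)"
        unfolding powr_add[symmetric] using n by (simp add: of_nat_diff)
      also have "\<tau> powr (real (n - 1)) = \<tau> ^ (n - 1)" using t by (intro powr_realpow) auto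
      finally have eq: "\<tau> powr (- 1 - 2 * s) = \<tau> ^ (n - 1) / \<tau> powr ?N"
        by (simp only: powr_minus_divide times_divide_eq_right mult_1_right)
      have "K * ((r * \<tau>) ^ (n - 1) / (1 + r * \<tau>) powr ?N) = (1 + r) powr ?N * \<tau> ^ (n - 1) / (1 + r * \<tau>) powr ?N"
        using r by (simp add: K_def power_mult_distrib)
      moreover have "\<tau> ^ (n - 1) / \<tau> powr ?N = (1 + r) powr ?N * \<tau> ^ (n - 1) / ((1 + r) powr ?N * \<tau> powr ?N)"
        using r by simp
      moreover have "\<dots> \<le> (1 + r) powr ?N * \<tau> ^ (n - 1) / (1 + r * \<tau>) powr ?N"
        using le pos t by (intro divide_left_mono mult_pos_pos) auto
      ultimately show ?thesis unfolding eq by (simp only:)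
    qed
    then have "\<bar>v (r * \<tau>)\<bar> * \<tau> powr (- 1 - 2 * s) \<le> \<bar>v (r * \<tau>)\<bar> * (K * ((r * \<tau>) ^ (n - 1) / (1 + r * \<tau>) powr ?N))"
      by (rule mult_left_mono) simp
    also have "\<dots> = K * ?G (r * \<tau>)" by simp
    finally have 1: "\<bar>v (r * \<tau>)\<bar> * \<tau> powr (- 1 - 2 * s) \<le> K * ?G (r * \<tau>)" .
    have "\<bar>b - v (r * \<tau>)\<bar> * \<tau> powr (- 1 - 2 * s) \<le> (\<bar>b\<bar> + \<bar>v (r * \<tau>)\<bar>) * \<tau> powr (- 1 - 2 * s)"
      by (intro mult_right_mono) auto
    with 1 show "\<bar>\<bar>b - v (r * \<tau>)\<bar> * \<tau> powr (- 1 - 2 * s)\<bar> \<le> \<bar>b\<bar> * \<tau> powr (- 1 - 2 * s) + K * ?G (r * \<tau>)"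
      by (simp add: abs_mult distrib_right)
  qed auto
qed

theorem theorem1p1:
  fixes u :: "real \<Rightarrow> real" and s :: real and x :: "real^'n"
  assumes n2: "CARD('n) \<ge> 2"
    and s: "0 < s" "s < 1"
    and C2: "C2_on_UNIV (\<lambda>y::real^'n. u (norm y))"
    and growth: "(\<lambda>r. \<bar>u r\<bar> / (1 + r) powr (real CARD('n) + 2 * s) * r ^ (CARD('n) - 1))
                   integrable_on {0..}"
    and x: "norm x > 0"
  shows "has_frac_laplacian s (\<lambda>y::real^'n. u (norm y)) x
           (frac_const s CARD('n) * norm x powr (- 2 * s) *
              integral {1..} (\<lambda>\<tau>. (u (norm x) - u (norm x * \<tau>)
                  + (u (norm x) - u (norm x / \<tau>)) * \<tau> powr (- real CARD('n) + 2 * s))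
                  * \<tau> * (\<tau>\<^sup>2 - 1) powr (- 1 - 2 * s) * H_fun s CARD('n) \<tau>))"
proof -
  define n where "n = CARD('n)"
  define r where "r = norm x"
  define c where "c = real (n - 1) * unit_ball_vol (real (n - 1))"
  \<comment> \<open>The hypotheses constrain \<open>u\<close> on nonnegative arguments only; the
    even extension makes \<open>g\<close> continuous, hence Borel, on the whole line.\<close>
  define v where "v t = u \<bar>t\<bar>" for t
  define g where "g \<tau> = u r - v (r * \<tau>)" for \<tau>
  have n: "n \<ge> 2" using n2 by (simp add: n_def)
  have r: "r > 0" and x0: "x \<noteq> 0" using x by (auto simp: r_def)
  define N where "N = real n + 2 * s"
  have N: "N \<ge> 0" using s by (simp add: N_def)
  obtain C a where C: "C \<ge> 0"
    and exp: "\<And>\<rho>. 0 \<le> \<rho> \<Longrightarrow> \<rho> \<le> 2 * r \<Longrightarrow> \<bar>u \<rho> - u r - a * (\<rho> - r)\<bar> \<le> C * (\<rho> - r)\<^sup>2"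
    and "continuous_on UNIV (\<lambda>t. u \<bar>t\<bar>)"
    by (rule C2_radial_expansion[OF C2 r]) (rule that)
  then have cont: "continuous_on UNIV v" by (simp only: v_def[abs_def])
  have "continuous_on UNIV (\<lambda>\<tau>. v (r * \<tau>))"
    by (rule continuous_on_compose2[OF cont]) (auto intro!: continuous_intros)
  then have "continuous_on UNIV g" unfolding g_def[abs_def] by (intro continuous_intros)
  then have g[measurable]: "g \<in> borel_measurable borel" by (rule borel_measurable_continuous_onI)
  \<comment> \<open>The expansion of \<open>u\<close> at \<open>r\<close> is evaluated at
    \<open>r * \<tau>\<close> and changes sign, which gives the coefficients \<open>- a * r\<close>
    and \<open>C * r\<^sup>2\<close>.\<close>
  have expansion: "\<bar>g \<tau> - (- a * r) * (\<tau> - 1)\<bar> \<le> C * r\<^sup>2 * (\<tau> - 1)\<^sup>2" if "0 \<le> \<tau>" "\<tau> \<le> 2" for \<tau>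
  proof -
    have "0 \<le> r * \<tau>" "r * \<tau> \<le> 2 * r" using that r by auto
    from exp[OF this]
    have "\<bar>- (g \<tau> - (- a * r) * (\<tau> - 1))\<bar> \<le> C * (r * (\<tau> - 1))\<^sup>2"
      using \<open>0 \<le> r * \<tau>\<close> by (simp add: g_def v_def algebra_simps)
    then show ?thesis by (simp only: abs_minus_cancel power_mult_distrib mult.assoc)
  qed
  have C': "C * r\<^sup>2 \<ge> 0" using C by simp
  have growth': "(\<lambda>\<rho>. \<bar>v \<rho>\<bar> / (1 + \<rho>) powr (real n + 2 * s) * \<rho> ^ (n - 1)) integrable_on {0..}"
    by (rule integrable_eq[OF growth]) (auto simp: v_def n_def)
  have tail: "set_integrable lborel {1<..} (\<lambda>\<tau>. \<bar>g \<tau>\<bar> * \<tau> powr (- 1 - 2 * s))"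
    unfolding g_def using set_integrable_tail[OF r s(1) cont growth'] n by simp
  note asm = s n g C' expansion tail
  let ?I = "\<lambda>\<delta>. LBINT \<tau>:{0<..}. g \<tau> * (\<tau> ^ (n - 1) * ang_ker n (n + 2 * s) \<delta> \<tau>)"
  let ?F = "\<lambda>\<tau>. (u r - u (r * \<tau>) + (u r - u (r / \<tau>)) * \<tau> powr (- real n + 2 * s))
                  * \<tau> * (\<tau>\<^sup>2 - 1) powr (- 1 - 2 * s) * H_fun s n \<tau>"
  let ?fold = "\<lambda>\<tau>. folded g s n \<tau> * (\<tau> ^ (n - 1) * ang_ker n (n + 2 * s) 0 \<tau>)"
  have trunc: "frac_trunc s (\<lambda>y. u (norm y)) x e = r powr (- 2 * s) * (c * ?I (e / r))" if e: "e > 0" for e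
  proof -
    have er: "e / r > 0" using e r by simp
    have gx: "g (norm y / r) = u (norm x) - u (norm y)" for y :: "real^'n"
      using r by (simp add: g_def v_def r_def)
    have "integrable lborel (\<lambda>\<tau>. g \<tau> * (indicator {0<..} \<tau> * \<tau> ^ (n - 1) * ang_ker n N (e / r) \<tau>))"
      using integrable_positive[OF asm er] by (simp add: set_integrable_def N_def mult_ac)
    note this[unfolded n_def r_def]
    from integrable_radial_ang_ker[OF n2 N x0 e g this] integral_radial_ang_ker[OF n2 N x0 e g this]
    have i: "integrable lborel (\<lambda>y. g (norm y / r) * (dist x y powr - N * indicator {e<..} (dist x y)))"
      and eq: "(\<integral>y. g (norm y / r) * (dist x y powr - N * indicator {e<..} (dist x y)) \<partial>lborel)
        = r ^ n * r powr (- N) * c * (\<integral>\<tau>. g \<tau> * (indicator {0<..} \<tau> * \<tau> ^ (n - 1) * ang_ker n N (e / r) \<tau>) \<partial>lborel)"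
      by (simp_all only: n_def r_def c_def)
    have pw: "g (norm y / r) * (dist x y powr - N * indicator {e<..} (dist x y))
       = indicator {y. e < dist x y} y *\<^sub>R ((u (norm x) - u (norm y)) / dist x y powr (real CARD('n) + 2 * s))" for y
      by (simp add: gx powr_minus_divide N_def n_def indicator_def del: minus_add_distrib)
    \<comment> \<open>\<open>integral\<close> in \<open>frac_trunc\<close> is the gauge integral;
      Lebesgue integrability is what identifies the two integrals.\<close>
    have si: "set_integrable lborel {y. e < dist x y} (\<lambda>y. (u (norm x) - u (norm y)) / dist x y powr (real CARD('n) + 2 * s))"
      using i unfolding pw set_integrable_def .
    have "frac_trunc s (\<lambda>y. u (norm y)) x e
        = (LBINT y:{y. e < dist x y}. (u (norm x) - u (norm y)) / dist x y powr (real CARD('n) + 2 * s))"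
      unfolding frac_trunc_def by (rule set_borel_integral_eq_integral(2)[OF si, symmetric])
    also have "\<dots> = r ^ n * r powr (- N) * c * ?I (e / r)"
      using eq unfolding pw by (simp add: set_lebesgue_integral_def N_def mult_ac)
    also have "r ^ n * r powr (- N) = r powr (- 2 * s)"
    proof -
      have "r ^ n * r powr (- N) = r powr (real n) * r powr (- N)" using r by (simp add: powr_realpow)
      also have "\<dots> = r powr (- 2 * s)" unfolding powr_add[symmetric] by (simp add: N_def)
      finally show ?thesis .
    qed
    finally show ?thesis by (simp only: mult.assoc)
  qed
  have foldF: "c * ?fold \<tau> = ?F \<tau>" if t: "\<tau> > 1" for \<tau>
  proof -
    have "g \<tau> = u r - u (r * \<tau>)" "g (1 / \<tau>) = u r - u (r / \<tau>)"
      using t r by (simp_all add: g_def v_def)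
    then have f: "folded g s n \<tau> = u r - u (r * \<tau>) + (u r - u (r / \<tau>)) * \<tau> powr (- real n + 2 * s)"
      by (simp add: folded_def[OF asm] add.commute)
    have "c * ?fold \<tau> = folded g s n \<tau> * (c * \<tau> ^ (n - 1) * ang_ker n (n + 2 * s) 0 \<tau>)" by simp
    also have "\<dots> = folded g s n \<tau> * (\<tau> * (\<tau>\<^sup>2 - 1) powr (- 1 - 2 * s) * H_fun s n \<tau>)"
      unfolding c_def by (simp only: ang_ker_eq_H_fun[OF s(1) n t])
    finally show ?thesis unfolding f by (simp only: mult.assoc)
  qed
  have "set_integrable lborel {1<..} (\<lambda>\<tau>. c * ?fold \<tau>)"
    by (rule set_integrable_mult_right) (rule integrable_folded[OF asm])
  then have siF: "set_integrable lborel {1<..} ?F"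
    by (subst (asm) set_integrable_cong[OF refl refl foldF]) auto
  have "c * (LBINT \<tau>:{1<..}. ?fold \<tau>) = (LBINT \<tau>:{1<..}. c * ?fold \<tau>)"
    by (rule set_integral_mult_right[symmetric])
  also have "\<dots> = (LBINT \<tau>:{1<..}. ?F \<tau>)"
    by (rule set_lebesgue_integral_cong) (simp, use foldF in blast)
  also have "\<dots> = integral {1<..} ?F" by (rule set_borel_integral_eq_integral(2)[OF siF])
  also have "\<dots> = integral {1..} ?F"
    by (rule integral_subset_negligible) (auto intro: negligible_subset[of "{1}"])
  finally have rhs: "c * (LBINT \<tau>:{1<..}. ?fold \<tau>) = integral {1..} ?F" .
  \<comment> \<open>In units of \<open>r\<close> the truncation radius \<open>e\<close> becomes
    \<open>\<delta> = e / r\<close>, which also tends to 0 from the right.\<close>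
  have "((\<lambda>e. e / r) \<longlongrightarrow> 0 / r) (at_right 0)" using r by (intro tendsto_intros) auto
  then have "filterlim (\<lambda>e. e / r) (at_right 0) (at_right 0)"
    using r by (auto simp: filterlim_at eventually_at_filter)
  from filterlim_compose[OF pv_limit[OF asm n_def] this]
  have "((\<lambda>e. frac_const s CARD('n) * (r powr (- 2 * s) * (c * ?I (e / r))))
      \<longlongrightarrow> frac_const s CARD('n) * (r powr (- 2 * s) * (c * (LBINT \<tau>:{1<..}. ?fold \<tau>)))) (at_right 0)"
    by (intro tendsto_intros)
  moreover have "eventually (\<lambda>e. frac_const s CARD('n) * (r powr (- 2 * s) * (c * ?I (e / r)))
     = frac_const s CARD('n) * frac_trunc s (\<lambda>y::real^'n. u (norm y)) x e) (at_right 0)"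
    using eventually_at_right_less[of "0::real"] by eventually_elim (simp only: trunc)
  ultimately have "((\<lambda>e. frac_const s CARD('n) * frac_trunc s (\<lambda>y::real^'n. u (norm y)) x e)
      \<longlongrightarrow> frac_const s CARD('n) * (r powr (- 2 * s) * integral {1..} ?F)) (at_right 0)"
    unfolding rhs by (rule Lim_transform_eventually)
  then show ?thesis
    unfolding has_frac_laplacian_def r_def n_def by (simp only: mult.assoc)
qed

end
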